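(* Let $\Gamma$ be a finite set with $|\Gamma|\geq 2$ and let $\ell\geq 2$. Then no innately transitive permutation group on $\Gamma^\ell$ of simple diagonal type is contained in the wreath product $\mathrm{Sym}(\Gamma)\,\mathrm{wr}\,S_\ell$ acting in product action on $\Gamma^\ell$.
   Context: All permutation groups are finite. A permutation group is innately transitive if it has a transitive minimal normal subgroup; such a minimal normal subgroup is called a plinth. Product action: $\mathrm{Sym}(\Gamma)\,\mathrm{wr}\,S_\ell=\mathrm{Sym}(\Gamma)^\ell\rtimes S_\ell$ with $(x_1,\ldots,x_\ell)^{\sigma^{-1}}=(x_{1\sigma},\ldots,x_{\ell\sigma})$ acts on $\Gamma^\ell$ by $(\gamma_1,\ldots,\gamma_\ell)(x_1,\ldots,x_\ell)=(\gamma_1x_1,\ldots,\gamma_\ell x_\ell)$ and $(\gamma_1,\ldots,\gamma_\ell)\sigma^{-1}=(\gamma_{1\sigma},\ldots,\gamma_{\ell\sigma})$ (permutations act on the right). Diagonal type: let $G$ be innately transitive on $\Omega$ with non-abelian plinth $M=T_1\times\cdots\times T_k$, the $T_i$ being non-abelian simple groups all isomorphic to $T$, and let $\sigma_i:M\to T_i$ be the natural projections. $G$ has diagonal type if $\sigma_i(M_\omega)=T_i$ for all $\omega\in\Omega$ and all $i\in\{1,\ldots,k\}$. In this case $M_\omega\cong T^s$ for some $s\geq 1$; $G$ has simple diagonal type if $s=1$. *)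

theory Defs
  imports "HOL-Algebra.Algebra" "HOL-Combinatorics.Permutations"
begin

text \<open>
  Permutations of \<open>\<Omega>\<close> are the extensional bijections forming the carrier of \<open>BijGroup \<Omega>\<close>.
  Composition in \<open>BijGroup\<close> is right-to-left. With permutations acting on the right one obtains
  the opposite multiplication on the same set of permutations; (normal) subgroups, stabilisers,
  orbits, direct decompositions into commuting factors and isomorphism of subgroups
  are not affected by this.
\<close>

abbreviation perms :: "'a set \<Rightarrow> ('a \<Rightarrow> 'a) set \<Rightarrow> ('a \<Rightarrow> 'a) monoid" where
  "perms \<Omega> H \<equiv> (BijGroup \<Omega>)\<lparr>carrier := H\<rparr>"

definition permutation_group :: "'a set \<Rightarrow> ('a \<Rightarrow> 'a) set \<Rightarrow> bool" where
  "permutation_group \<Omega> G \<longleftrightarrow> finite \<Omega> \<and> subgroup G (BijGroup \<Omega>)"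

definition minimal_normal_subgroup :: "'g set \<Rightarrow> ('g, 'b) monoid_scheme \<Rightarrow> bool" where
  "minimal_normal_subgroup N G \<longleftrightarrow>
     N \<lhd> G \<and> N \<noteq> {\<one>\<^bsub>G\<^esub>} \<and> (\<forall>K. K \<lhd> G \<and> K \<subseteq> N \<longrightarrow> K = {\<one>\<^bsub>G\<^esub>} \<or> K = N)"

definition plinth :: "'a set \<Rightarrow> ('a \<Rightarrow> 'a) set \<Rightarrow> ('a \<Rightarrow> 'a) set \<Rightarrow> bool" where
  "plinth \<Omega> G M \<longleftrightarrow>
     minimal_normal_subgroup M (perms \<Omega> G) \<and> transitive_action (perms \<Omega> M) \<Omega> (\<lambda>g. g)"

definition innately_transitive :: "'a set \<Rightarrow> ('a \<Rightarrow> 'a) set \<Rightarrow> bool" where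
  "innately_transitive \<Omega> G \<longleftrightarrow> permutation_group \<Omega> G \<and> (\<exists>M. plinth \<Omega> G M)"


text \<open>
  \<open>G\<close> is the internal direct product of its subgroups \<open>T 1, \<dots>, T k\<close>: the map
  \<open>(t\<^sub>1, \<dots>, t\<^sub>k) \<mapsto> t\<^sub>1 \<otimes> \<cdots> \<otimes> t\<^sub>k\<close> is an isomorphism from the external direct product.
  The natural projections are the components of its inverse.
\<close>

definition factor_mult :: "('g, 'b) monoid_scheme \<Rightarrow> nat \<Rightarrow> (nat \<Rightarrow> 'g) \<Rightarrow> 'g" where
  "factor_mult G k t = foldr (\<lambda>i y. t i \<otimes>\<^bsub>G\<^esub> y) [1..<Suc k] \<one>\<^bsub>G\<^esub>"

definition internal_direct_product ::
    "('g, 'b) monoid_scheme \<Rightarrow> nat \<Rightarrow> (nat \<Rightarrow> 'g set) \<Rightarrow> bool" where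
  "internal_direct_product G k T \<longleftrightarrow>
     (\<forall>i\<in>{1..k}. subgroup (T i) G) \<and>
     factor_mult G k \<in> iso (product_group {1..k} (\<lambda>i. G\<lparr>carrier := T i\<rparr>)) G"

definition natural_projection ::
    "('g, 'b) monoid_scheme \<Rightarrow> nat \<Rightarrow> (nat \<Rightarrow> 'g set) \<Rightarrow> nat \<Rightarrow> 'g \<Rightarrow> 'g" where
  "natural_projection G k T i g = inv_into (\<Pi>\<^sub>E j\<in>{1..k}. T j) (factor_mult G k) g i"


definition nonabelian_simple_decomposition ::
    "('g, 'b) monoid_scheme \<Rightarrow> nat \<Rightarrow> (nat \<Rightarrow> 'g set) \<Rightarrow> bool" where
  "nonabelian_simple_decomposition M k T \<longleftrightarrow>
     k \<ge> 1 \<and> internal_direct_product M k T \<and>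
     (\<forall>i\<in>{1..k}. simple_group (M\<lparr>carrier := T i\<rparr>) \<and> \<not> comm_group (M\<lparr>carrier := T i\<rparr>)) \<and>
     (\<forall>i\<in>{1..k}. \<forall>j\<in>{1..k}. M\<lparr>carrier := T i\<rparr> \<cong> M\<lparr>carrier := T j\<rparr>)"

abbreviation point_stabilizer :: "'a set \<Rightarrow> ('a \<Rightarrow> 'a) set \<Rightarrow> 'a \<Rightarrow> ('a \<Rightarrow> 'a) set" where
  "point_stabilizer \<Omega> M \<omega> \<equiv> stabilizer (perms \<Omega> M) (\<lambda>g. g) \<omega>"

definition diagonal_type_wrt ::
    "'a set \<Rightarrow> ('a \<Rightarrow> 'a) set \<Rightarrow> ('a \<Rightarrow> 'a) set \<Rightarrow> nat \<Rightarrow> (nat \<Rightarrow> ('a \<Rightarrow> 'a) set) \<Rightarrow> bool" where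
  "diagonal_type_wrt \<Omega> G M k T \<longleftrightarrow>
     innately_transitive \<Omega> G \<and> plinth \<Omega> G M \<and>
     nonabelian_simple_decomposition (perms \<Omega> M) k T \<and>
     (\<forall>\<omega>\<in>\<Omega>. \<forall>i\<in>{1..k}.
        natural_projection (perms \<Omega> M) k T i ` point_stabilizer \<Omega> M \<omega> = T i)"

definition diagonal_type :: "'a set \<Rightarrow> ('a \<Rightarrow> 'a) set \<Rightarrow> bool" where
  "diagonal_type \<Omega> G \<longleftrightarrow> (\<exists>M k T. diagonal_type_wrt \<Omega> G M k T)"

text \<open>
  In diagonal type \<open>M\<^sub>\<omega>\<close> is isomorphic to \<open>T\<^sup>s\<close> where \<open>T\<close> is the common isomorphism type of
  the \<open>T i\<close>; simple diagonal type is the case \<open>s = 1\<close>.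
\<close>

definition simple_diagonal_type :: "'a set \<Rightarrow> ('a \<Rightarrow> 'a) set \<Rightarrow> bool" where
  "simple_diagonal_type \<Omega> G \<longleftrightarrow>
     (\<exists>M k T. diagonal_type_wrt \<Omega> G M k T \<and>
        (\<forall>\<omega>\<in>\<Omega>. \<forall>i\<in>{1..k}. perms \<Omega> (point_stabilizer \<Omega> M \<omega>) \<cong> perms \<Omega> (T i)))"


definition cartesian_power :: "'a set \<Rightarrow> nat \<Rightarrow> (nat \<Rightarrow> 'a) set" where
  "cartesian_power \<Gamma> l = {1..l} \<rightarrow>\<^sub>E \<Gamma>"

definition base_action ::
    "'a set \<Rightarrow> nat \<Rightarrow> (nat \<Rightarrow> 'a \<Rightarrow> 'a) \<Rightarrow> (nat \<Rightarrow> 'a) \<Rightarrow> nat \<Rightarrow> 'a" where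
  "base_action \<Gamma> l x = (\<lambda>\<gamma>\<in>cartesian_power \<Gamma> l. \<lambda>i\<in>{1..l}. x i (\<gamma> i))"

text \<open>The permutation by which \<open>\<sigma>\<^sup>-\<^sup>1\<close>, rather than \<open>\<sigma>\<close>, acts on the right.\<close>

definition top_inv_action ::
    "'a set \<Rightarrow> nat \<Rightarrow> (nat \<Rightarrow> nat) \<Rightarrow> (nat \<Rightarrow> 'a) \<Rightarrow> nat \<Rightarrow> 'a" where
  "top_inv_action \<Gamma> l \<sigma> = (\<lambda>\<gamma>\<in>cartesian_power \<Gamma> l. \<lambda>i\<in>{1..l}. \<gamma> (\<sigma> i))"

text \<open>
  The permutations of \<open>\<Gamma>\<^sup>l\<close> induced by the elements \<open>(x\<^sub>1, \<dots>, x\<^sub>l)\<sigma>\<^sup>-\<^sup>1\<close> of \<open>Sym \<Gamma> wr S\<^sub>l\<close>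
  in product action; acting on the right, the base element is applied first.
\<close>

definition wreath_product_action :: "'a set \<Rightarrow> nat \<Rightarrow> ((nat \<Rightarrow> 'a) \<Rightarrow> nat \<Rightarrow> 'a) set" where
  "wreath_product_action \<Gamma> l =
     {compose (cartesian_power \<Gamma> l) (top_inv_action \<Gamma> l \<sigma>) (base_action \<Gamma> l x) | x \<sigma>.
        x \<in> {1..l} \<rightarrow>\<^sub>E carrier (BijGroup \<Gamma>) \<and> \<sigma> permutes {1..l}}"

lemma wreath_elem_eq:
  assumes "\<And>i. i \<in> {1..l} \<Longrightarrow> x i \<in> Bij \<Gamma>" and "\<sigma> permutes {1..l}"
  shows "compose (cartesian_power \<Gamma> l) (top_inv_action \<Gamma> l \<sigma>) (base_action \<Gamma> l x)
           = (\<lambda>\<gamma>\<in>cartesian_power \<Gamma> l. \<lambda>i\<in>{1..l}. x (\<sigma> i) (\<gamma> (\<sigma> i)))"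
proof
  fix \<gamma>
  have sig: "\<sigma> i \<in> {1..l}" if "i \<in> {1..l}" for i
    using permutes_in_image[OF assms(2)] that by blast
  have "(\<lambda>i\<in>{1..l}. x i (\<gamma> i)) \<in> cartesian_power \<Gamma> l" if "\<gamma> \<in> cartesian_power \<Gamma> l"
    unfolding cartesian_power_def
  proof (rule restrict_PiE_iff[THEN iffD2], rule ballI)
    fix i assume i: "i \<in> {1..l}"
    then have "\<gamma> i \<in> \<Gamma>" using that unfolding cartesian_power_def by (meson PiE_mem)
    then show "x i (\<gamma> i) \<in> \<Gamma>" using Bij_imp_funcset[OF assms(1)[OF i]] by blast
  qed
  then show "compose (cartesian_power \<Gamma> l) (top_inv_action \<Gamma> l \<sigma>) (base_action \<Gamma> l x) \<gamma> =
      (\<lambda>\<gamma>\<in>cartesian_power \<Gamma> l. \<lambda>i\<in>{1..l}. x (\<sigma> i) (\<gamma> (\<sigma> i))) \<gamma>"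
    using sig
    by (cases "\<gamma> \<in> cartesian_power \<Gamma> l")
      (auto simp: compose_def top_inv_action_def base_action_def restrict_def)
qed

lemma wreath_elemI:
  assumes "\<And>i. i \<in> {1..l} \<Longrightarrow> x i \<in> Bij \<Gamma>" and "\<sigma> permutes {1..l}"
  shows "(\<lambda>\<gamma>\<in>cartesian_power \<Gamma> l. \<lambda>i\<in>{1..l}. x (\<sigma> i) (\<gamma> (\<sigma> i))) \<in> wreath_product_action \<Gamma> l"
proof -
  let ?x = "restrict x {1..l}"
  have sig: "\<sigma> i \<in> {1..l}" if "i \<in> {1..l}" for i
    using permutes_in_image[OF assms(2)] that by blast
  have x: "?x \<in> {1..l} \<rightarrow>\<^sub>E carrier (BijGroup \<Gamma>)"
    using assms(1) by (auto simp: BijGroup_def)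
  have "(\<lambda>\<gamma>\<in>cartesian_power \<Gamma> l. \<lambda>i\<in>{1..l}. x (\<sigma> i) (\<gamma> (\<sigma> i)))
      = (\<lambda>\<gamma>\<in>cartesian_power \<Gamma> l. \<lambda>i\<in>{1..l}. ?x (\<sigma> i) (\<gamma> (\<sigma> i)))"
    by (intro restrict_ext) (use sig in simp)
  also have "\<dots> = compose (cartesian_power \<Gamma> l) (top_inv_action \<Gamma> l \<sigma>) (base_action \<Gamma> l ?x)"
    by (rule wreath_elem_eq[symmetric]) (use assms in auto)
  finally show ?thesis
    unfolding wreath_product_action_def using x assms(2) by blast
qed

lemma wreath_elemE:
  assumes "w \<in> wreath_product_action \<Gamma> l"
  obtains x \<sigma> where "\<forall>i\<in>{1..l}. x i \<in> Bij \<Gamma>" and "\<sigma> permutes {1..l}"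
    and "w = (\<lambda>\<gamma>\<in>cartesian_power \<Gamma> l. \<lambda>i\<in>{1..l}. x (\<sigma> i) (\<gamma> (\<sigma> i)))"
proof -
  obtain x \<sigma> where x: "x \<in> {1..l} \<rightarrow>\<^sub>E carrier (BijGroup \<Gamma>)" and s: "\<sigma> permutes {1..l}"
    and w: "w = compose (cartesian_power \<Gamma> l) (top_inv_action \<Gamma> l \<sigma>) (base_action \<Gamma> l x)"
    using assms unfolding wreath_product_action_def by blast
  have bij: "\<forall>i\<in>{1..l}. x i \<in> Bij \<Gamma>"
    using PiE_mem[OF x] by (simp add: BijGroup_def)
  have "w = (\<lambda>\<gamma>\<in>cartesian_power \<Gamma> l. \<lambda>i\<in>{1..l}. x (\<sigma> i) (\<gamma> (\<sigma> i)))"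
    unfolding w by (rule wreath_elem_eq) (use bij s in blast)+
  then show thesis
    by (rule that[OF bij s])
qed

lemma wreath_elem_closed:
  assumes "\<And>i. i \<in> {1..l} \<Longrightarrow> x i \<in> Bij \<Gamma>" and "\<sigma> permutes {1..l}"
    and "\<gamma> \<in> cartesian_power \<Gamma> l"
  shows "(\<lambda>i\<in>{1..l}. x (\<sigma> i) (\<gamma> (\<sigma> i))) \<in> cartesian_power \<Gamma> l"
  unfolding cartesian_power_def
proof (rule restrict_PiE_iff[THEN iffD2], rule ballI)
  fix i assume "i \<in> {1..l}"
  then have i: "\<sigma> i \<in> {1..l}" using permutes_in_image[OF assms(2)] by blast
  then have "\<gamma> (\<sigma> i) \<in> \<Gamma>" using assms(3) unfolding cartesian_power_def by (meson PiE_mem)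
  then show "x (\<sigma> i) (\<gamma> (\<sigma> i)) \<in> \<Gamma>" using Bij_imp_funcset[OF assms(1)[OF i]] by blast
qed

lemma wreath_compose_closed:
  assumes "v \<in> wreath_product_action \<Gamma> l" "w \<in> wreath_product_action \<Gamma> l"
  shows "compose (cartesian_power \<Gamma> l) v w \<in> wreath_product_action \<Gamma> l"
proof -
  obtain y \<tau> where y0: "\<forall>i\<in>{1..l}. y i \<in> Bij \<Gamma>" and t: "\<tau> permutes {1..l}"
    and v: "v = (\<lambda>\<gamma>\<in>cartesian_power \<Gamma> l. \<lambda>i\<in>{1..l}. y (\<tau> i) (\<gamma> (\<tau> i)))"
    by (rule wreath_elemE[OF assms(1)])
  obtain x \<sigma> where x0: "\<forall>i\<in>{1..l}. x i \<in> Bij \<Gamma>" and s: "\<sigma> permutes {1..l}"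
    and w: "w = (\<lambda>\<gamma>\<in>cartesian_power \<Gamma> l. \<lambda>i\<in>{1..l}. x (\<sigma> i) (\<gamma> (\<sigma> i)))"
    by (rule wreath_elemE[OF assms(2)])
  note x = x0[rule_format] and y = y0[rule_format]
  let ?s' = "inv_into UNIV \<sigma>"
  let ?z = "\<lambda>j. compose \<Gamma> (y (?s' j)) (x j)"
  have s'_in: "?s' j \<in> {1..l}" if "j \<in> {1..l}" for j
    using permutes_in_image[OF permutes_inv[OF s]] that by blast
  have s's: "?s' (\<sigma> j) = j" for j
    using permutes_inverses(2)[OF s] .
  have s_in: "\<sigma> i \<in> {1..l}" and t_in: "\<tau> i \<in> {1..l}" if "i \<in> {1..l}" for i
    using permutes_in_image[OF s] permutes_in_image[OF t] that by blast+
  have z: "?z j \<in> Bij \<Gamma>" if "j \<in> {1..l}" for j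
    using compose_Bij[OF y[OF s'_in[OF that]] x[OF that]] .
  have "compose (cartesian_power \<Gamma> l) v w =
      (\<lambda>\<gamma>\<in>cartesian_power \<Gamma> l. \<lambda>i\<in>{1..l}. ?z ((\<sigma> \<circ> \<tau>) i) (\<gamma> ((\<sigma> \<circ> \<tau>) i)))"
  proof
    fix \<gamma>
    show "compose (cartesian_power \<Gamma> l) v w \<gamma> =
      (\<lambda>\<gamma>\<in>cartesian_power \<Gamma> l. \<lambda>i\<in>{1..l}. ?z ((\<sigma> \<circ> \<tau>) i) (\<gamma> ((\<sigma> \<circ> \<tau>) i))) \<gamma>"
    proof (cases "\<gamma> \<in> cartesian_power \<Gamma> l")
      case True
      have g: "\<gamma> i \<in> \<Gamma>" if "i \<in> {1..l}" for i
        using True that unfolding cartesian_power_def by (meson PiE_mem)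
      have "w \<gamma> \<in> cartesian_power \<Gamma> l"
        using wreath_elem_closed[OF x s True] True by (simp add: w)
      then show ?thesis
        using True g s_in t_in
        by (simp add: compose_eq v, intro restrict_ext) (simp add: w compose_eq s's)
    qed (simp add: compose_def)
  qed
  also have "\<dots> \<in> wreath_product_action \<Gamma> l"
    by (rule wreath_elemI[OF z permutes_compose[OF t s]])
  finally show ?thesis .
qed

lemma wreath_inverse_ex:
  assumes "w \<in> wreath_product_action \<Gamma> l"
  shows "\<exists>v\<in>wreath_product_action \<Gamma> l.
    (\<forall>\<gamma>\<in>cartesian_power \<Gamma> l. v \<gamma> \<in> cartesian_power \<Gamma> l \<and> w \<gamma> \<in> cartesian_power \<Gamma> l \<and>
      v (w \<gamma>) = \<gamma> \<and> w (v \<gamma>) = \<gamma>)"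
proof -
  obtain x \<sigma> where x0: "\<forall>i\<in>{1..l}. x i \<in> Bij \<Gamma>" and s: "\<sigma> permutes {1..l}"
    and w: "w = (\<lambda>\<gamma>\<in>cartesian_power \<Gamma> l. \<lambda>i\<in>{1..l}. x (\<sigma> i) (\<gamma> (\<sigma> i)))"
    by (rule wreath_elemE[OF assms])
  note x = x0[rule_format]
  let ?s' = "inv_into UNIV \<sigma>"
  let ?y = "\<lambda>i. \<lambda>a\<in>\<Gamma>. inv_into \<Gamma> (x (\<sigma> i)) a"
  define v where "v = (\<lambda>\<gamma>\<in>cartesian_power \<Gamma> l. \<lambda>i\<in>{1..l}. ?y (?s' i) (\<gamma> (?s' i)))"
  have v_eq: "v \<gamma> i = (if i \<in> {1..l} then ?y (?s' i) (\<gamma> (?s' i)) else undefined)"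
    and w_eq: "w \<gamma> i = (if i \<in> {1..l} then x (\<sigma> i) (\<gamma> (\<sigma> i)) else undefined)"
    if "\<gamma> \<in> cartesian_power \<Gamma> l" for \<gamma> i
    unfolding v_def w by (simp_all add: that del: atLeastAtMost_iff)
  have s': "?s' permutes {1..l}" using permutes_inv[OF s] .
  have ss': "\<sigma> (?s' j) = j" and s's: "?s' (\<sigma> j) = j" for j
    using permutes_inverses[OF s] by auto
  have s_in: "\<sigma> i \<in> {1..l}" and s'_in: "?s' i \<in> {1..l}" if "i \<in> {1..l}" for i
    using permutes_in_image[OF s] permutes_in_image[OF s'] that by blast+
  have y: "?y i \<in> Bij \<Gamma>" if "i \<in> {1..l}" for i
    using restrict_inv_into_Bij[OF x[OF s_in[OF that]]] .
  have "v \<in> wreath_product_action \<Gamma> l" unfolding v_def by (rule wreath_elemI[OF y s'])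
  moreover have "v \<gamma> \<in> cartesian_power \<Gamma> l \<and> w \<gamma> \<in> cartesian_power \<Gamma> l \<and>
      v (w \<gamma>) = \<gamma> \<and> w (v \<gamma>) = \<gamma>" if G: "\<gamma> \<in> cartesian_power \<Gamma> l" for \<gamma>
  proof -
    have g: "\<gamma> i \<in> \<Gamma>" if "i \<in> {1..l}" for i
      using G that unfolding cartesian_power_def by (meson PiE_mem)
    have und: "\<gamma> i = undefined" if "i \<notin> {1..l}" for i
      using G that unfolding cartesian_power_def by (meson PiE_arb)
    have v_in: "v \<gamma> \<in> cartesian_power \<Gamma> l"
      using wreath_elem_closed[OF y s' G] G by (simp add: v_def)
    have w_in: "w \<gamma> \<in> cartesian_power \<Gamma> l"
      using wreath_elem_closed[OF x s G] G by (simp add: w)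
    have bij: "bij_betw (x i) \<Gamma> \<Gamma>" if "i \<in> {1..l}" for i
      using x[OF that] by (simp add: Bij_def)
    have i1: "inv_into \<Gamma> (x i) (x i a) = a" if "i \<in> {1..l}" "a \<in> \<Gamma>" for i a
      using bij_betw_inv_into_left[OF bij[OF that(1)] that(2)] .
    have i2: "x i (inv_into \<Gamma> (x i) a) = a" if "i \<in> {1..l}" "a \<in> \<Gamma>" for i a
      using bij_betw_inv_into_right[OF bij[OF that(1)] that(2)] .
    have im: "x i a \<in> \<Gamma>" if "i \<in> {1..l}" "a \<in> \<Gamma>" for i a
      using bij_betwE[OF bij[OF that(1)]] that(2) by blast
    have "v (w \<gamma>) i = \<gamma> i" for i
    proof (cases "i \<in> {1..l}")
      case True
      have "w \<gamma> (?s' i) = x i (\<gamma> i)"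
        by (simp only: w_eq[OF G] s'_in[OF True] ss' if_True)
      then show ?thesis
        by (simp only: v_eq[OF w_in] True ss' if_True restrict_apply im[OF True g[OF True]]
            i1[OF True g[OF True]])
    next
      case False
      then show ?thesis by (simp only: v_eq[OF w_in] und[OF False] if_False)
    qed
    moreover have "w (v \<gamma>) i = \<gamma> i" for i
    proof (cases "i \<in> {1..l}")
      case True
      have "v \<gamma> (\<sigma> i) = inv_into \<Gamma> (x (\<sigma> i)) (\<gamma> i)"
        by (simp only: v_eq[OF G] s_in[OF True] s's if_True restrict_apply g[OF True])
      then show ?thesis
        by (simp only: w_eq[OF v_in] True if_True i2[OF s_in[OF True] g[OF True]])
    next
      case False
      then show ?thesis by (simp only: w_eq[OF v_in] und[OF False] if_False)
    qed
    ultimately show ?thesis using v_in w_in by (intro conjI ext)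
  qed
  ultimately show ?thesis by blast
qed

lemma subgroup_wreath_product_action:
  "subgroup (wreath_product_action \<Gamma> l) (BijGroup (cartesian_power \<Gamma> l))"
proof -
  let ?P = "cartesian_power \<Gamma> l" and ?W = "wreath_product_action \<Gamma> l"
  interpret group "BijGroup ?P" by (rule group_BijGroup)
  have sub: "w \<in> Bij ?P" if W: "w \<in> ?W" for w
  proof -
    from wreath_inverse_ex[OF W]
    obtain v where v: "\<forall>\<gamma>\<in>?P. v \<gamma> \<in> ?P \<and> w \<gamma> \<in> ?P \<and> v (w \<gamma>) = \<gamma> \<and> w (v \<gamma>) = \<gamma>" ..
    have "bij_betw w ?P ?P"
      by (rule bij_betw_byWitness[where f' = v]) (use v in blast)+
    moreover have "w \<in> extensional ?P"
      by (rule wreath_elemE[OF W]) (simp only: restrict_extensional)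
    ultimately show ?thesis by (simp add: Bij_def)
  qed
  show ?thesis
  proof (rule subgroupI)
    show "?W \<subseteq> carrier (BijGroup ?P)" using sub by (simp add: BijGroup_def subset_iff)
    have "(\<lambda>\<gamma>\<in>?P. \<lambda>i\<in>{1..l}. (\<lambda>a\<in>\<Gamma>. a) (\<gamma> (id i))) \<in> ?W"
      by (rule wreath_elemI[OF id_Bij permutes_id])
    then show "?W \<noteq> {}" by blast
    show "v \<otimes>\<^bsub>BijGroup ?P\<^esub> w \<in> ?W" if "v \<in> ?W" "w \<in> ?W" for v w
      using wreath_compose_closed[OF that] sub[OF that(1)] sub[OF that(2)]
      by (simp add: BijGroup_def)
    show "inv\<^bsub>BijGroup ?P\<^esub> w \<in> ?W" if W: "w \<in> ?W" for w
    proof -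
      from wreath_inverse_ex[OF W] obtain v where vW: "v \<in> ?W"
        and v: "\<forall>\<gamma>\<in>?P. v \<gamma> \<in> ?P \<and> w \<gamma> \<in> ?P \<and> v (w \<gamma>) = \<gamma> \<and> w (v \<gamma>) = \<gamma>" ..
      have "compose ?P v w = (\<lambda>\<gamma>\<in>?P. \<gamma>)"
        unfolding compose_def by (rule restrict_ext) (use v in blast)
      then have "v \<otimes>\<^bsub>BijGroup ?P\<^esub> w = \<one>\<^bsub>BijGroup ?P\<^esub>"
        using sub[OF W] sub[OF vW] by (simp add: BijGroup_def)
      then have "inv\<^bsub>BijGroup ?P\<^esub> w = v"
        using sub[OF W] sub[OF vW] by (intro inv_equality) (simp_all add: BijGroup_def)
      then show ?thesis using vW by simp
    qed
  qed
qed

end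

theory Submission
  imports Defs
begin

text \<open>
  Let \<open>M = T\<^sub>1 \<times> \<dots> \<times> T\<^sub>k\<close> be the plinth, \<open>q\<close> the common order of the \<open>T\<^sub>j\<close>, \<open>n\<close> the order of
  \<open>\<Gamma>\<close> and \<open>D = M\<^sub>\<omega>\<close>. Simple diagonal type means that every projection maps \<open>D\<close> bijectively
  onto \<open>T\<^sub>j\<close>, so that \<open>n\<^sup>l q = q\<^sup>k\<close>. The contradiction comes from counting the pairs \<open>(i, j)\<close>
  such that \<open>T\<^sub>j\<close> moves the \<open>i\<close>-th coordinate of some point.

  The elements of \<open>M\<close> do not permute the coordinates (\<open>M_preserves_coordinates\<close>). Otherwise, by
  minimality, \<open>M\<close> would embed into \<open>S\<^sub>l\<close>; but \<open>n\<^sup>l\<close> divides the order of the transitive group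
  \<open>M\<close>, whereas it does not divide \<open>l!\<close>. Hence \<open>M\<close> acts on each coordinate, and the stabiliser
  \<open>K\<^sub>i\<close> of the \<open>i\<close>-th coordinate of \<open>\<omega>\<close> has index \<open>n\<close> in \<open>M\<close>. It contains \<open>D\<close>, and so projects
  onto every \<open>T\<^sub>j\<close>. The factor \<open>T\<^sub>j\<close> moves the coordinate \<open>i\<close> exactly if it is not contained in
  \<open>K\<^sub>i\<close>; let \<open>u\<^sub>i\<close> be the number of these factors.

  The core is the pair of inequalities \<open>q\<^bsup>u\<^sub>i\<^esup> \<le> n\<^sup>2\<close> and \<open>n q \<le> q\<^bsup>u\<^sub>i\<^esup>\<close>
  (\<open>subdirect_index_bounds\<close>). They reflect that \<open>K\<^sub>i\<close> is a product of diagonal subgroups over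
  the blocks of a partition of the factors: \<open>n\<close> is \<open>q\<close> to the power of \<open>k\<close> minus the number of
  blocks, and \<open>u\<^sub>i\<close> factors lie in blocks of size at least two. Both are proved by
  comparing orders of subgroups that intersect trivially.

  Conjugation by \<open>G\<close> permutes the factors and the coordinates; by minimality of \<open>M\<close>, all factors
  move the same number \<open>d\<close> of coordinates (\<open>card_moved_factor_le\<close>). Therefore
  \<open>u\<^sub>1 + \<dots> + u\<^sub>l = k d\<close>. Multiplying the first inequality over all \<open>i\<close> gives
  \<open>k d \<le> 2 (k - 1)\<close>, so \<open>d \<le> 1\<close>; multiplying the second one gives
  \<open>k - 1 + l \<le> k d \<le> k\<close>, so \<open>l \<le> 1\<close>.
\<close>

section \<open>Powers dividing factorials\<close>

text \<open>
  The multiples of \<open>p\<close> among \<open>1, \<dots>, l\<close> contribute \<open>p\<^sup>m m!\<close> to \<open>l!\<close> with \<open>m = l div p\<close>, and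
  the other factors are coprime to \<open>p\<close>. If \<open>p\<^sup>l\<close> divided \<open>l!\<close>, then \<open>p\<^bsup>l - m\<^esup>\<close> would divide
  \<open>m!\<close>; since \<open>m \<le> l - m\<close>, so would \<open>p\<^sup>m\<close>, and the induction applies.
\<close>

lemma prime_power_self_not_dvd_fact:
  fixes p :: nat
  assumes "Factorial_Ring.prime p" "l \<ge> 1"
  shows "\<not> p ^ l dvd fact l"
  using assms(2)
proof (induction l rule: less_induct)
  case (less l)
  show ?case
  proof
    assume dvd: "p ^ l dvd fact l"
    have p2: "p \<ge> 2" using assms(1) by (simp add: prime_ge_2_nat)
    define m where "m = l div p"
    let ?A = "\<Prod>{i\<in>{1..l}. \<not> p dvd i}"
    have mult: "{i\<in>{1..l}. p dvd i} = (\<lambda>j. p * j) ` {1..m}"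
    proof
      show "{i\<in>{1..l}. p dvd i} \<subseteq> (\<lambda>j. p * j) ` {1..m}"
      proof
        fix i assume i: "i \<in> {i\<in>{1..l}. p dvd i}"
        then obtain j where j: "i = p * j" by auto
        then have "j \<in> {1..m}"
          using i p2 by (auto simp: m_def less_eq_div_iff_mult_less_eq mult.commute)
        then show "i \<in> (\<lambda>j. p * j) ` {1..m}" using j by blast
      qed
      show "(\<lambda>j. p * j) ` {1..m} \<subseteq> {i\<in>{1..l}. p dvd i}"
        using p2 by (auto simp: m_def less_eq_div_iff_mult_less_eq mult.commute Suc_le_eq)
    qed
    have "fact l = \<Prod>{1..l}" by (simp add: fact_prod)
    also have "\<dots> = ?A * \<Prod>{i\<in>{1..l}. p dvd i}"
      by (subst prod.union_disjoint[symmetric]) (auto intro: prod.cong)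
    also have "\<Prod>{i\<in>{1..l}. p dvd i} = (\<Prod>j\<in>{1..m}. p * j)"
      unfolding mult using p2 by (subst prod.reindex) (auto simp: inj_on_def)
    also have "\<dots> = p ^ m * fact m" by (simp add: prod.distrib fact_prod)
    finally have split: "(fact l :: nat) = ?A * (p ^ m * fact m)" .
    have "coprime (p ^ l) ?A"
      using assms(1) by (auto intro!: prod_coprime_right simp: prime_imp_coprime_nat)
    then have "p ^ l dvd p ^ m * fact m"
      using dvd unfolding split by (simp add: coprime_dvd_mult_right_iff)
    moreover have ml: "2 * m \<le> l"
    proof -
      have "p * m \<le> l" unfolding m_def by simp
      then show ?thesis using mult_le_mono1[OF p2, of m] by linarith
    qed
    have "p ^ l = p ^ m * p ^ (l - m)" using ml by (simp flip: power_add)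
    ultimately have *: "p ^ (l - m) dvd fact m" using p2 by simp
    moreover have "p ^ m dvd p ^ (l - m)" using ml by (intro le_imp_power_dvd) simp
    ultimately have "p ^ m dvd fact m" using dvd_trans by blast
    show False
    proof (cases "m = 0")
      case True
      then show ?thesis using * less.prems p2 by simp
    next
      case False
      then show ?thesis using less.IH[of m] \<open>p ^ m dvd fact m\<close> ml by linarith
    qed
  qed
qed

lemma power_self_not_dvd_fact:
  fixes n :: nat
  assumes "n \<ge> 2" "l \<ge> 1"
  shows "\<not> n ^ l dvd fact l"
proof -
  obtain p where "Factorial_Ring.prime p" "p dvd n" using assms(1) prime_factor_nat[of n] by auto
  then show ?thesis
    using prime_power_self_not_dvd_fact[OF _ assms(2)] dvd_power_same dvd_trans by blast
qed

section \<open>Subgroups of products of non-abelian simple groups\<close>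

text \<open>The map \<open>(a, b) \<mapsto> a b\<close> from \<open>A \<times> B\<close> to \<open>C\<close> is injective.\<close>

lemma (in group) card_mult_le_if_Int_trivial:
  assumes "subgroup A G" "subgroup B G" "A \<inter> B = {\<one>}" "A \<subseteq> C" "B \<subseteq> C" "subgroup C G" "finite C"
  shows "card A * card B \<le> card C"
proof -
  interpret A: subgroup A G by fact
  interpret B: subgroup B G by fact
  interpret C: subgroup C G by fact
  have "inj_on (\<lambda>(a, b). a \<otimes> b) (A \<times> B)"
  proof (rule inj_onI, clarsimp)
    fix a b a' b' assume m: "a \<in> A" "b \<in> B" "a' \<in> A" "b' \<in> B" "a \<otimes> b = a' \<otimes> b'"
    have "inv a' \<otimes> a = b' \<otimes> inv b"
    proof -
      have "inv a' \<otimes> (a \<otimes> b) \<otimes> inv b = inv a' \<otimes> (a' \<otimes> b') \<otimes> inv b" using m by simp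
      moreover have "inv a' \<otimes> (a \<otimes> b) \<otimes> inv b = inv a' \<otimes> a" using m(1-4) by (simp add: m_assoc)
      moreover have "inv a' \<otimes> (a' \<otimes> b') \<otimes> inv b = b' \<otimes> inv b"
        using m(1-4) by (simp add: m_assoc[symmetric])
      ultimately show ?thesis by simp
    qed
    moreover have "inv a' \<otimes> a \<in> A" "b' \<otimes> inv b \<in> B" using m by auto
    ultimately have "inv a' \<otimes> a = \<one>" "b' \<otimes> inv b = \<one>" using assms(3) by auto
    then show "a = a' \<and> b = b'" using m
      by (metis A.mem_carrier B.mem_carrier inv_equality inv_inv inv_closed r_inv inv_solve_right l_one)
  qed
  moreover have "(\<lambda>(a, b). a \<otimes> b) ` (A \<times> B) \<subseteq> C" using assms(4,5) by auto
  ultimately show ?thesis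
    using card_inj_on_le[OF _ _ assms(7)] by (metis card_cartesian_product)
qed

lemma (in group) nonabelian_subgroup_witness:
  assumes "subgroup H G" "\<not> comm_group (G\<lparr>carrier := H\<rparr>)"
  obtains a b where "a \<in> H" "b \<in> H" "a \<otimes> b \<noteq> b \<otimes> a"
proof -
  interpret H: group "G\<lparr>carrier := H\<rparr>" using assms(1) by (rule subgroup_imp_group)
  show thesis using H.group_comm_groupI assms(2) that by fastforce
qed

text \<open>
  An internal direct product of non-abelian simple groups of the same order \<open>q\<close>, given by its
  factors \<open>T i\<close> and its projections \<open>p i\<close>. The projections take values in the group itself,
  which allows elements of the group and of its factors to be compared directly.
\<close>

locale nonabelian_simple_product = group G for G (structure) +
  fixes I :: "'i set" and T :: "'i \<Rightarrow> 'a set" and p :: "'i \<Rightarrow> 'a \<Rightarrow> 'a" and q :: nat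
  assumes finite_carrier: "finite (carrier G)"
    and finite_index: "finite I"
    and factor_subgroup: "i \<in> I \<Longrightarrow> subgroup (T i) G"
    and proj_hom: "i \<in> I \<Longrightarrow> p i \<in> hom G G"
    and proj_in: "i \<in> I \<Longrightarrow> x \<in> carrier G \<Longrightarrow> p i x \<in> T i"
    and proj_factor: "i \<in> I \<Longrightarrow> t \<in> T i \<Longrightarrow> p i t = t"
    and proj_other_factor: "i \<in> I \<Longrightarrow> j \<in> I \<Longrightarrow> i \<noteq> j \<Longrightarrow> t \<in> T j \<Longrightarrow> p i t = \<one>"
    and proj_ext: "x \<in> carrier G \<Longrightarrow> y \<in> carrier G \<Longrightarrow> (\<And>i. i \<in> I \<Longrightarrow> p i x = p i y) \<Longrightarrow> x = y"
    and factor_simple: "i \<in> I \<Longrightarrow> simple_group (G\<lparr>carrier := T i\<rparr>)"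
    and factor_nonabelian: "i \<in> I \<Longrightarrow> \<not> comm_group (G\<lparr>carrier := T i\<rparr>)"
    and card_factor: "i \<in> I \<Longrightarrow> card (T i) = q"
begin

lemma factor_sub: "i \<in> I \<Longrightarrow> T i \<subseteq> carrier G"
  using factor_subgroup subgroup.subset by blast

lemma proj_carrier: "i \<in> I \<Longrightarrow> x \<in> carrier G \<Longrightarrow> p i x \<in> carrier G"
  using proj_in factor_sub by blast

lemma proj_mult:
  "i \<in> I \<Longrightarrow> x \<in> carrier G \<Longrightarrow> y \<in> carrier G \<Longrightarrow> p i (x \<otimes> y) = p i x \<otimes> p i y"
  by (rule hom_mult[OF proj_hom])

lemma proj_group_hom: "i \<in> I \<Longrightarrow> group_hom G G (p i)"
  using proj_hom by unfold_locales auto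

lemma proj_one: "i \<in> I \<Longrightarrow> p i \<one> = \<one>"
  using group_hom.hom_one[OF proj_group_hom] .

lemma proj_inv: "i \<in> I \<Longrightarrow> x \<in> carrier G \<Longrightarrow> p i (inv x) = inv (p i x)"
  using group_hom.hom_inv[OF proj_group_hom] .

lemmas proj_simps = proj_mult proj_one proj_inv proj_carrier

definition subproduct :: "'i set \<Rightarrow> 'a set" where
  "subproduct S = {x \<in> carrier G. \<forall>i\<in>I - S. p i x = \<one>}"

lemma subproduct_subgroup: "subgroup (subproduct S) G"
  by (rule subgroupI) (auto simp: subproduct_def proj_simps)

lemma subproduct_conj:
  "x \<in> subproduct S \<Longrightarrow> y \<in> carrier G \<Longrightarrow> y \<otimes> x \<otimes> inv y \<in> subproduct S"
  by (auto simp: subproduct_def proj_simps)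

lemma subproduct_empty: "subproduct {} = {\<one>}"
  using proj_ext[of _ \<one>] by (auto simp: subproduct_def proj_simps)

lemma subproduct_all: "subproduct I = carrier G"
  by (auto simp: subproduct_def)

lemma subproduct_singleton:
  assumes j: "j \<in> I" shows "subproduct {j} = T j"
proof (intro subset_antisym subsetI)
  fix x assume x: "x \<in> subproduct {j}"
  then have xG: "x \<in> carrier G" by (simp add: subproduct_def)
  have "p i x = p i (p j x)" if "i \<in> I" for i
  proof (cases "i = j")
    case True
    then show ?thesis using proj_factor[OF j proj_in[OF j xG]] by simp
  next
    case False
    then show ?thesis
      using x that proj_other_factor[OF that j False proj_in[OF j xG]] by (simp add: subproduct_def)
  qed
  then have "x = p j x" by (rule proj_ext[OF xG proj_carrier[OF j xG]])
  then show "x \<in> T j" using proj_in[OF j xG] by simp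
next
  fix t assume t: "t \<in> T j"
  then show "t \<in> subproduct {j}"
    using factor_sub[OF j] proj_other_factor[OF _ j _ t] by (auto simp: subproduct_def)
qed

lemma subproduct_mono: "S \<subseteq> S' \<Longrightarrow> subproduct S \<subseteq> subproduct S'"
  by (auto simp: subproduct_def)

lemma subproduct_insert_decomp:
  assumes "j \<in> I" "j \<notin> S" "x \<in> subproduct (insert j S)"
  shows "x \<otimes> inv (p j x) \<in> subproduct S" "p j x \<in> T j"
    "x = (x \<otimes> inv (p j x)) \<otimes> p j x"
proof -
  have x: "x \<in> carrier G" using assms(3) by (simp add: subproduct_def)
  show "p j x \<in> T j" using proj_in assms(1) x .
  then have "p i (p j x) = (if i = j then p j x else \<one>)" if "i \<in> I" for i
    using that assms(1) proj_factor proj_other_factor by auto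
  then show "x \<otimes> inv (p j x) \<in> subproduct S"
    using assms x by (auto simp: subproduct_def proj_simps)
  show "x = (x \<otimes> inv (p j x)) \<otimes> p j x"
    using x assms(1) by (simp add: m_assoc proj_simps)
qed

text \<open>Splitting off the component at \<open>j\<close> is a bijection from \<open>subproduct (insert j S)\<close> to \<open>subproduct S \<times> T j\<close>.\<close>

lemma card_subproduct:
  assumes "S \<subseteq> I" shows "card (subproduct S) = q ^ card S"
  using finite_subset[OF assms finite_index] assms
proof (induction S rule: finite_induct)
  case empty
  then show ?case by (simp add: subproduct_empty)
next
  case (insert j S)
  have j: "j \<in> I" using insert.prems by auto
  have "bij_betw (\<lambda>(a, t). a \<otimes> t) (subproduct S \<times> T j) (subproduct (insert j S))"
  proof (rule bij_betw_byWitness[where f' = "\<lambda>x. (x \<otimes> inv (p j x), p j x)"])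
    have S: "a \<in> carrier G" "p j a = \<one>" if "a \<in> subproduct S" for a
      using that j insert.hyps(2) by (auto simp: subproduct_def)
    have Tj: "t \<in> carrier G" "p j t = t" if "t \<in> T j" for t
      using that factor_sub[OF j] proj_factor[OF j] by auto
    show "\<forall>x\<in>subproduct S \<times> T j.
        (\<lambda>x. (x \<otimes> inv (p j x), p j x)) (case x of (a, t) \<Rightarrow> a \<otimes> t) = x"
      using S Tj j by (auto simp: proj_mult m_assoc)
    show "\<forall>x\<in>subproduct (insert j S). (case (x \<otimes> inv (p j x), p j x) of (a, t) \<Rightarrow> a \<otimes> t) = x"
      using subproduct_insert_decomp(3)[OF j insert.hyps(2)] by auto
    have sub: "subproduct S \<subseteq> subproduct (insert j S)" "T j \<subseteq> subproduct (insert j S)"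
      using subproduct_mono[of S "insert j S"] subproduct_mono[of "{j}" "insert j S"]
        subproduct_singleton[OF j] by auto
    show "(\<lambda>(a, t). a \<otimes> t) ` (subproduct S \<times> T j) \<subseteq> subproduct (insert j S)"
      by (clarify, rule subgroup.m_closed[OF subproduct_subgroup])
        (erule subsetD[OF sub(1)], erule subsetD[OF sub(2)])
    show "(\<lambda>x. (x \<otimes> inv (p j x), p j x)) ` subproduct (insert j S) \<subseteq> subproduct S \<times> T j"
      using subproduct_insert_decomp(1,2)[OF j insert.hyps(2)] by auto
  qed
  from bij_betw_same_card[OF this] show ?case
    using insert card_factor[OF j] by (simp add: card_cartesian_product mult.commute)
qed

lemma card_carrier: "card (carrier G) = q ^ card I"
  using card_subproduct[of I] by (simp add: subproduct_all)

lemma subproduct_subset_if_factors_subset: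
  assumes "S \<subseteq> I" "subgroup K G" "\<And>j. j \<in> S \<Longrightarrow> T j \<subseteq> K"
  shows "subproduct S \<subseteq> K"
  using finite_subset[OF assms(1) finite_index] assms(1,3)
proof (induction S rule: finite_induct)
  case empty
  then show ?case using subgroup.one_closed[OF assms(2)] by (simp add: subproduct_empty)
next
  case (insert j S)
  show ?case
  proof
    fix x assume x: "x \<in> subproduct (insert j S)"
    have j: "j \<in> I" using insert.prems by auto
    note d = subproduct_insert_decomp[OF j insert.hyps(2) x]
    have "x \<otimes> inv (p j x) \<in> K" "p j x \<in> K" using d insert by auto
    then show "x \<in> K" using d(3) subgroup.m_closed[OF assms(2)] by metis
  qed
qed

lemma q_ge_2: "i \<in> I \<Longrightarrow> q \<ge> 2"
  using simple_group.order_gt_one[OF factor_simple] card_factor by (fastforce simp: order_def)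

lemma factor_witness:
  assumes "i \<in> I"
  obtains a b where "a \<in> T i" "b \<in> T i" "a \<otimes> b \<noteq> b \<otimes> a"
  using nonabelian_subgroup_witness[OF factor_subgroup factor_nonabelian] assms by metis

text \<open>
  This is how simplicity enters all later arguments: since \<open>K\<close> maps onto \<open>T i\<close> and normalises
  \<open>A\<close>, the image of \<open>A\<close> is normal in \<open>T i\<close>.
\<close>

lemma proj_image_trivial_or_full:
  assumes i: "i \<in> I" and K: "K \<subseteq> carrier G" "p i ` K = T i"
    and A: "subgroup A G" and conj: "\<And>x a. x \<in> K \<Longrightarrow> a \<in> A \<Longrightarrow> x \<otimes> a \<otimes> inv x \<in> A"
  shows "p i ` A = {\<one>} \<or> p i ` A = T i"
proof -
  let ?T = "G\<lparr>carrier := T i\<rparr>"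
  interpret Ti: simple_group ?T by (rule factor_simple[OF i])
  interpret A: subgroup A G by (rule A)
  interpret pi: group_hom G G "p i" by (rule proj_group_hom[OF i])
  have sub: "subgroup (p i ` A) G" using pi.subgroup_img_is_subgroup[OF A] .
  have subT: "p i ` A \<subseteq> T i" using proj_in[OF i] A.subset by auto
  have "subgroup (p i ` A) ?T" using subgroup_incl[OF sub factor_subgroup[OF i] subT] .
  moreover have "t \<otimes>\<^bsub>?T\<^esub> h \<otimes>\<^bsub>?T\<^esub> inv\<^bsub>?T\<^esub> t \<in> p i ` A" if t: "t \<in> T i" and h: "h \<in> p i ` A" for t h
  proof -
    obtain x where x: "x \<in> K" "t = p i x" using t K(2) by auto
    obtain a where a: "a \<in> A" "h = p i a" using h by auto
    have "x \<in> carrier G" using x K(1) by auto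
    then have "t \<otimes> h \<otimes> inv t = p i (x \<otimes> a \<otimes> inv x)"
      using x a i by (simp add: proj_simps)
    then show ?thesis using conj[OF x(1) a(1)] m_inv_consistent[OF factor_subgroup[OF i] t] by auto
  qed
  ultimately have "p i ` A \<lhd> ?T" using Ti.normal_inv_iff by auto
  from Ti.no_real_normal_subgroup[OF this] show ?thesis by auto
qed

text \<open>
  A non-trivial normal subgroup \<open>N\<close> maps onto some \<open>T j\<close>. The commutator of an element of \<open>N\<close>
  with an element of \<open>T j\<close> lies in \<open>N \<inter> T j\<close>, and it can be chosen non-trivial because \<open>T j\<close> is
  non-abelian; so \<open>N \<inter> T j\<close>, being normal, is all of \<open>T j\<close>.
\<close>

lemma normal_subgroup_contains_factor:
  assumes N: "N \<lhd> G" and nt: "N \<noteq> {\<one>}"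
  obtains j where "j \<in> I" "T j \<subseteq> N"
proof -
  interpret N: normal N G by (rule N)
  have full: "p i ` carrier G = T i" if "i \<in> I" for i
    using that proj_in proj_factor factor_sub by (auto simp: image_iff) (metis subsetD)
  obtain x where x: "x \<in> N" "x \<noteq> \<one>" using nt N.one_closed by auto
  have xG: "x \<in> carrier G" using x N.subset by auto
  obtain j where j: "j \<in> I" "p j x \<noteq> \<one>" using x proj_ext[OF xG one_closed] proj_one by metis
  have Nj: "p j ` N = T j"
    using proj_image_trivial_or_full[OF j(1) subset_refl full[OF j(1)] N.subgroup_axioms] N.inv_op_closed2
      x(1) j(2) by fastforce
  obtain a b where ab: "a \<in> T j" "b \<in> T j" "a \<otimes> b \<noteq> b \<otimes> a" by (rule factor_witness[OF j(1)])
  have abG: "a \<in> carrier G" "b \<in> carrier G" using ab factor_sub j by auto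
  obtain y where y: "y \<in> N" "a = p j y" using Nj ab(1) by auto
  have yG: "y \<in> carrier G" using y N.subset by auto
  let ?c = "y \<otimes> (b \<otimes> inv y \<otimes> inv b)"
  have cN: "?c \<in> N" using y N.inv_op_closed2[OF abG(2), of "inv y"] by simp
  have "p i ?c = \<one>" if "i \<in> I" "i \<noteq> j" for i
    using that abG yG proj_other_factor[OF that(1) j(1) that(2) ab(2)] by (simp add: proj_simps)
  then have cT: "?c \<in> subproduct {j}" using abG yG by (auto simp: subproduct_def)
  have "p j ?c = a \<otimes> (b \<otimes> inv a \<otimes> inv b)"
    using abG yG j(1) y(2) proj_factor[OF j(1) ab(2)] by (simp add: proj_simps)
  moreover have "a \<otimes> (b \<otimes> inv a \<otimes> inv b) = (a \<otimes> b) \<otimes> inv (b \<otimes> a)"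
    using abG by (simp add: inv_mult_group m_assoc)
  moreover have "(a \<otimes> b) \<otimes> inv (b \<otimes> a) \<noteq> \<one>"
    using ab abG by (metis inv_solve_right l_one m_closed one_closed)
  ultimately have c1: "p j ?c \<noteq> \<one>" by simp
  have sub: "subgroup (subproduct {j} \<inter> N) G"
    using subgroups_Inter_pair[OF subproduct_subgroup N.subgroup_axioms] .
  have "p j ` (subproduct {j} \<inter> N) = T j"
    using proj_image_trivial_or_full[OF j(1) subset_refl full[OF j(1)] sub]
      N.inv_op_closed2 subproduct_conj c1 cN cT by fastforce
  moreover have "p j ` (subproduct {j} \<inter> N) = subproduct {j} \<inter> N"
    using proj_factor[OF j(1)] by (simp add: subproduct_singleton[OF j(1)])
  ultimately have "T j \<subseteq> N" by auto
  then show thesis using that j(1) by blast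
qed

text \<open>
  Let \<open>S\<close> be maximal among the sets of factors not contained in \<open>K\<close> whose subproduct meets \<open>K\<close>
  trivially. Adding a further such factor \<open>j\<close> to \<open>S\<close> creates an intersection
  \<open>A (insert j S)\<close> with \<open>K\<close> which projects onto \<open>T j\<close> and onto some factors in \<open>S\<close>, those in
  \<open>F j\<close>. For different \<open>j\<close>, two such intersections commute elementwise, because their
  commutators lie in \<open>A S\<close>; as the factors are non-abelian, the sets \<open>F j\<close> are disjoint.
  Since they are also non-empty subsets of \<open>S\<close>, their number is at most \<open>card S\<close>.
\<close>

lemma subdirect_complement_in_moved_factors:
  assumes K: "subgroup K G" and subdirect: "\<And>i. i \<in> I \<Longrightarrow> p i ` K = T i"
  obtains S where "S \<subseteq> {j\<in>I. \<not> T j \<subseteq> K}" "subproduct S \<inter> K = {\<one>}"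
    "card {j\<in>I. \<not> T j \<subseteq> K} \<le> 2 * card S"
proof -
  interpret K: subgroup K G by (rule K)
  define U where "U = {j\<in>I. \<not> T j \<subseteq> K}"
  have UI: "U \<subseteq> I" and finU: "finite U" using finite_index by (auto simp: U_def)
  define A where "A = (\<lambda>S. subproduct S \<inter> K)"
  have Asub: "subgroup (A S) G" for S
    unfolding A_def using subgroups_Inter_pair[OF subproduct_subgroup K] .
  have Aone: "\<one> \<in> A S" for S using subgroup.one_closed[OF Asub] .
  have dich: "p i ` A S = {\<one>} \<or> p i ` A S = T i" if "i \<in> I" for i S
    by (rule proj_image_trivial_or_full[OF that K.subset subdirect[OF that] Asub])
      (auto simp: A_def subproduct_conj)
  have Tnt: "T i \<noteq> {\<one>}" if "i \<in> I" for i
    using q_ge_2[OF that] card_factor[OF that] by auto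
  \<comment> \<open>\<open>T j \<inter> K\<close> is normalised by \<open>K\<close> and is its own projection, so it is trivial or all of \<open>T j\<close>.\<close>
  have single: "A {j} = {\<one>}" if "j \<in> U" for j
  proof -
    have j: "j \<in> I" "\<not> T j \<subseteq> K" using that by (auto simp: U_def)
    have "p j ` A {j} = A {j}"
      using proj_factor[OF j(1)] by (simp add: A_def subproduct_singleton[OF j(1)])
    then show ?thesis using dich[OF j(1), of "{j}"] j by (auto simp: A_def subproduct_singleton)
  qed
  define \<P> where "\<P> = {S. S \<subseteq> U \<and> A S = {\<one>}}"
  have "finite \<P>" using finU by (simp add: \<P>_def)
  moreover have "{} \<in> \<P>" by (auto simp: \<P>_def A_def subproduct_empty)
  ultimately obtain S where S: "S \<in> \<P>" and max: "\<And>S'. S' \<in> \<P> \<Longrightarrow> S \<subseteq> S' \<Longrightarrow> S = S'"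
    using finite_has_maximal[of \<P>] by (metis empty_iff)
  have SU: "S \<subseteq> U" and SA: "A S = {\<one>}" using S by (auto simp: \<P>_def)
  define F where "F = (\<lambda>j. {s\<in>S. p s ` A (insert j S) = T s})"
  have Ffull: "p j ` A (insert j S) = T j" if j: "j \<in> U - S" for j
  proof -
    have "A (insert j S) \<noteq> {\<one>}" using max[of "insert j S"] j SU by (auto simp: \<P>_def)
    then obtain x where x: "x \<in> A (insert j S)" "x \<noteq> \<one>" using Aone by blast
    have "p j x \<noteq> \<one>"
    proof
      assume "p j x = \<one>"
      then have "x \<in> A S" using x(1) by (auto simp: A_def subproduct_def)
      then show False using SA x(2) by auto
    qed
    then show ?thesis using dich[of j "insert j S"] x(1) j UI by auto
  qed
  have Fne: "F j \<noteq> {}" if j: "j \<in> U - S" for j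
  proof
    assume "F j = {}"
    then have "p s ` A (insert j S) = {\<one>}" if "s \<in> S" for s
      using dich[of s "insert j S"] that SU UI by (auto simp: F_def)
    then have "A (insert j S) \<subseteq> A {j}" by (force simp: A_def subproduct_def)
    then have "A (insert j S) \<subseteq> {\<one>}" using single j by auto
    then have "p j ` A (insert j S) \<subseteq> {\<one>}" using proj_one[of j] j UI by auto
    then have "T j \<subseteq> {\<one>}" using Ffull[OF j] by simp
    then show False using Tnt[of j] subgroup.one_closed[OF factor_subgroup[of j]] j UI by auto
  qed
  have Fdisj: "j = j'" if j: "j \<in> U - S" "j' \<in> U - S" and s: "s \<in> F j" "s \<in> F j'" for j j' s
  proof (rule ccontr)
    assume ne: "j \<noteq> j'"
    have sI: "s \<in> I" using s SU UI by (auto simp: F_def)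
    obtain a b where ab: "a \<in> T s" "b \<in> T s" "a \<otimes> b \<noteq> b \<otimes> a" by (rule factor_witness[OF sI])
    obtain x where x: "x \<in> A (insert j S)" "a = p s x" using s(1) ab(1) by (auto simp: F_def)
    obtain y where y: "y \<in> A (insert j' S)" "b = p s y" using s(2) ab(2) by (auto simp: F_def)
    have xy: "x \<in> carrier G" "y \<in> carrier G" "x \<in> K" "y \<in> K" using x y by (auto simp: A_def)
    let ?c = "(x \<otimes> y) \<otimes> inv (y \<otimes> x)"
    have "p i ?c = \<one>" if i: "i \<in> I - S" for i
    proof -
      have "p i x = \<one> \<or> p i y = \<one>" using x(1) y(1) i ne by (auto simp: A_def subproduct_def)
      then show ?thesis using i xy by (auto simp: proj_simps inv_mult_group)
    qed
    then have "?c \<in> A S" using xy by (auto simp: A_def subproduct_def)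
    then have "?c = \<one>" using SA by auto
    then have "x \<otimes> y = y \<otimes> x" using xy by (metis inv_solve_right l_one m_closed one_closed)
    then have "p s (x \<otimes> y) = p s (y \<otimes> x)" by simp
    then show False using ab(3) x(2) y(2) xy sI by (simp add: proj_mult)
  qed
  define f where "f = (\<lambda>j. SOME s. s \<in> F j)"
  have f: "f j \<in> F j" if "j \<in> U - S" for j using Fne[OF that] unfolding f_def by (simp add: some_in_eq)
  have "inj_on f (U - S)" by (rule inj_onI) (metis f Fdisj)
  moreover have "f ` (U - S) \<subseteq> S" using f by (auto simp: F_def)
  ultimately have "card (U - S) \<le> card S" using card_inj_on_le finite_subset[OF SU finU] by blast
  moreover have "card U = card (U - S) + card S"
    using SU finU by (metis card_Diff_subset card_mono finite_subset le_add_diff_inverse2)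
  ultimately show thesis using that[of S] SU SA by (auto simp: U_def A_def)
qed

text \<open>
  Both bounds come from subgroups that intersect trivially: \<open>K\<close> and the subproduct of the
  preceding lemma inside the whole group, and, inside \<open>K\<close>, the diagonal subgroup \<open>D\<close> and the
  subproduct of the factors contained in \<open>K\<close>.
\<close>

lemma subdirect_index_bounds:
  assumes K: "subgroup K G" and subdirect: "\<And>i. i \<in> I \<Longrightarrow> p i ` K = T i"
    and D: "subgroup D G" "D \<subseteq> K" "card D = q"
    and diag: "\<And>x i. x \<in> D \<Longrightarrow> i \<in> I \<Longrightarrow> p i x = \<one> \<Longrightarrow> x = \<one>"
    and index: "card (carrier G) = n * card K" and proper: "K \<noteq> carrier G"
  shows "q ^ card {j\<in>I. \<not> T j \<subseteq> K} \<le> n\<^sup>2" "n * q \<le> q ^ card {j\<in>I. \<not> T j \<subseteq> K}"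
proof -
  define U where "U = {j\<in>I. \<not> T j \<subseteq> K}"
  have UI: "U \<subseteq> I" by (auto simp: U_def)
  have finK: "finite K" using finite_subset[OF subgroup.subset[OF K] finite_carrier] .
  have Kpos: "card K > 0" using finK subgroup.one_closed[OF K] card_gt_0_iff by blast
  have "I \<noteq> {}"
  proof
    assume "I = {}"
    then have "carrier G = {\<one>}" using subproduct_all subproduct_empty by simp
    then show False using proper subgroup.subset[OF K] subgroup.one_closed[OF K] by auto
  qed
  then have q2: "q \<ge> 2" using q_ge_2 by auto
  have "U \<noteq> {}"
    using subproduct_subset_if_factors_subset[OF subset_refl K] proper subgroup.subset[OF K]
    by (auto simp: U_def subproduct_all)
  obtain S where S: "S \<subseteq> U" "subproduct S \<inter> K = {\<one>}" "card U \<le> 2 * card S"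
    unfolding U_def by (rule subdirect_complement_in_moved_factors[OF K subdirect])
  have "card (subproduct S) * card K \<le> card (carrier G)"
    using card_mult_le_if_Int_trivial[OF subproduct_subgroup K S(2) _ _ subgroup_self finite_carrier]
      subgroup.subset[OF K] subgroup.subset[OF subproduct_subgroup] by blast
  then have "q ^ card S \<le> n" using card_subproduct[of S] S(1) UI Kpos index by auto
  then have "(q ^ card S)\<^sup>2 \<le> n\<^sup>2" by (rule power_mono) simp
  moreover have "q ^ card U \<le> q ^ (card S * 2)" using S(3) q2 by (intro power_increasing) auto
  ultimately show "q ^ card {j\<in>I. \<not> T j \<subseteq> K} \<le> n\<^sup>2"
    unfolding U_def power_mult by (rule order_trans[rotated])
  have "subproduct (I - U) \<subseteq> K"
    by (rule subproduct_subset_if_factors_subset[OF _ K]) (auto simp: U_def)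
  \<comment> \<open>Elements of the intersection have a trivial component at some index in \<open>U\<close>; by \<open>diag\<close> they are trivial.\<close>
  moreover have "subproduct (I - U) \<inter> D = {\<one>}"
    using \<open>U \<noteq> {}\<close> diag subgroup.one_closed[OF subproduct_subgroup] subgroup.one_closed[OF D(1)] UI
    by (auto simp: subproduct_def)
  ultimately have "card (subproduct (I - U)) * card D \<le> card K"
    using card_mult_le_if_Int_trivial[OF subproduct_subgroup D(1) _ _ D(2) K finK] by blast
  then have "q ^ card (I - U) * q \<le> card K" using card_subproduct[of "I - U"] D(3) by auto
  then have "n * (q ^ card (I - U) * q) \<le> q ^ card I" using index card_carrier by simp
  moreover have "card I = card U + card (I - U)"
    using UI finite_index by (metis card_Diff_subset card_mono finite_subset le_add_diff_inverse)
  ultimately have "q ^ card (I - U) * (n * q) \<le> q ^ card (I - U) * q ^ card U"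
    by (simp add: power_add ac_simps)
  then show "n * q \<le> q ^ card {j\<in>I. \<not> T j \<subseteq> K}" using q2 by (simp add: U_def)
qed

end

section \<open>Permutations of a Cartesian power\<close>

lemma BijGroup_apply_in: "f \<in> carrier (BijGroup S) \<Longrightarrow> x \<in> S \<Longrightarrow> f x \<in> S"
  using Bij_imp_funcset[of f S] by (auto simp: BijGroup_def)

lemma BijGroup_mult_apply:
  "f \<in> carrier (BijGroup S) \<Longrightarrow> g \<in> carrier (BijGroup S) \<Longrightarrow> x \<in> S \<Longrightarrow> (f \<otimes>\<^bsub>BijGroup S\<^esub> g) x = f (g x)"
  by (simp add: BijGroup_def compose_eq)

lemma BijGroup_one_apply: "x \<in> S \<Longrightarrow> \<one>\<^bsub>BijGroup S\<^esub> x = x"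
  by (simp add: BijGroup_def)

lemma BijGroup_inv_apply:
  assumes "f \<in> carrier (BijGroup S)" "x \<in> S"
  shows "(inv\<^bsub>BijGroup S\<^esub> f) (f x) = x" "f ((inv\<^bsub>BijGroup S\<^esub> f) x) = x"
proof -
  interpret group "BijGroup S" by (rule group_BijGroup)
  have i: "inv\<^bsub>BijGroup S\<^esub> f \<in> carrier (BijGroup S)" using assms(1) by (rule inv_closed)
  show "(inv\<^bsub>BijGroup S\<^esub> f) (f x) = x"
    using BijGroup_mult_apply[OF i assms] BijGroup_one_apply[OF assms(2)] l_inv[OF assms(1)] by simp
  show "f ((inv\<^bsub>BijGroup S\<^esub> f) x) = x"
    using BijGroup_mult_apply[OF assms(1) i assms(2)] BijGroup_one_apply[OF assms(2)] r_inv[OF assms(1)] by simp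
qed

lemma finite_BijGroup: "finite S \<Longrightarrow> finite (carrier (BijGroup S))"
proof -
  assume "finite S"
  then have "finite (S \<rightarrow>\<^sub>E S)" by (simp add: finite_PiE)
  moreover have "carrier (BijGroup S) \<subseteq> S \<rightarrow>\<^sub>E S"
  proof
    fix f assume "f \<in> carrier (BijGroup S)"
    then have "f \<in> Bij S" by (simp add: BijGroup_def)
    then show "f \<in> S \<rightarrow>\<^sub>E S" by (simp add: PiE_def Bij_imp_funcset Bij_imp_extensional)
  qed
  ultimately show ?thesis by (rule rev_finite_subset)
qed

text \<open>
  The orbit-stabiliser theorem for a map \<open>f\<close> whose fibres are the left cosets of \<open>H\<close>, such as
  evaluation at a point, or evaluation at a point followed by a coordinate.
\<close>

lemma (in group) card_eq_card_fibres_mult: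
  assumes fin: "finite (carrier G)" and H: "subgroup H G"
    and surj: "f ` carrier G = Y"
    and fib: "\<And>x y. x \<in> carrier G \<Longrightarrow> y \<in> carrier G \<Longrightarrow> f x = f y \<longleftrightarrow> inv x \<otimes> y \<in> H"
  shows "card (carrier G) = card Y * card H"
proof -
  have finY: "finite Y" using fin surj by auto
  have fibre: "card {x \<in> carrier G. f x = y} = card H" if y: "y \<in> Y" for y
  proof -
    obtain x where x: "x \<in> carrier G" "y = f x" using y surj by auto
    have "bij_betw (\<lambda>h. x \<otimes> h) H {x' \<in> carrier G. f x' = y}"
    proof (rule bij_betw_byWitness[where f' = "\<lambda>x'. inv x \<otimes> x'"])
      show "\<forall>h\<in>H. inv x \<otimes> (x \<otimes> h) = h"
        using x subgroup.subset[OF H] by (auto simp: m_assoc[symmetric])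
      show "\<forall>x'\<in>{x' \<in> carrier G. f x' = y}. x \<otimes> (inv x \<otimes> x') = x'"
        using x by (auto simp: m_assoc[symmetric])
      show "(\<lambda>h. x \<otimes> h) ` H \<subseteq> {x' \<in> carrier G. f x' = y}"
      proof clarify
        fix h assume h: "h \<in> H"
        then have hG: "h \<in> carrier G" using subgroup.subset[OF H] by auto
        have "inv x \<otimes> (x \<otimes> h) = h" using x hG by (simp add: m_assoc[symmetric])
        then show "x \<otimes> h \<in> carrier G \<and> f (x \<otimes> h) = y"
          using fib[of x "x \<otimes> h"] x h hG by simp
      qed
      show "(\<lambda>x'. inv x \<otimes> x') ` {x' \<in> carrier G. f x' = y} \<subseteq> H"
      proof clarify
        fix x' assume "x' \<in> carrier G" "y = f x'"
        then show "inv x \<otimes> x' \<in> H" using fib[of x x'] x by simp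
      qed
    qed
    then show ?thesis using bij_betw_same_card by fastforce
  qed
  have "card (carrier G) = (\<Sum>y\<in>Y. \<Sum>x\<in>{x \<in> carrier G. f x = y}. 1)"
    using sum.group[OF fin finY, of f "\<lambda>_. 1::nat"] surj by simp
  also have "\<dots> = (\<Sum>y\<in>Y. card H)" using fibre by (intro sum.cong) auto
  finally show ?thesis by simp
qed

text \<open>
  The top component \<open>\<sigma>\<close> of an element of the wreath product, characterised by which coordinate
  of the argument determines which coordinate of the value. In this form it is defined for all
  maps, and \<open>\<sigma> = id\<close> says that \<open>w\<close> acts on each coordinate separately.
\<close>

definition coordinate_pullback :: "'a set \<Rightarrow> nat \<Rightarrow> ((nat \<Rightarrow> 'a) \<Rightarrow> nat \<Rightarrow> 'a) \<Rightarrow> (nat \<Rightarrow> nat) \<Rightarrow> bool" where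
  "coordinate_pullback \<Gamma> l w \<sigma> \<longleftrightarrow>
     (\<forall>\<gamma>\<in>cartesian_power \<Gamma> l. \<forall>\<gamma>'\<in>cartesian_power \<Gamma> l. \<forall>i\<in>{1..l}. \<gamma> (\<sigma> i) = \<gamma>' (\<sigma> i) \<longrightarrow> w \<gamma> i = w \<gamma>' i)"

lemma wreath_coordinate_pullback:
  assumes "w \<in> wreath_product_action \<Gamma> l"
  obtains \<sigma> where "\<sigma> permutes {1..l}" "coordinate_pullback \<Gamma> l w \<sigma>"
proof -
  obtain x \<sigma> where \<sigma>: "\<sigma> permutes {1..l}"
    and w: "w = (\<lambda>\<gamma>\<in>cartesian_power \<Gamma> l. \<lambda>i\<in>{1..l}. x (\<sigma> i) (\<gamma> (\<sigma> i)))"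
    using wreath_elemE[OF assms] by blast
  have "coordinate_pullback \<Gamma> l w \<sigma>" by (simp add: coordinate_pullback_def w)
  with \<sigma> show thesis by (rule that)
qed

lemma coordinate_pullback_mult:
  assumes v: "v \<in> carrier (BijGroup (cartesian_power \<Gamma> l))"
    and w: "w \<in> carrier (BijGroup (cartesian_power \<Gamma> l))"
    and v_pull: "coordinate_pullback \<Gamma> l v \<tau>" and w_pull: "coordinate_pullback \<Gamma> l w \<sigma>"
    and \<tau>: "\<tau> permutes {1..l}"
  shows "coordinate_pullback \<Gamma> l (v \<otimes>\<^bsub>BijGroup (cartesian_power \<Gamma> l)\<^esub> w) (\<sigma> \<circ> \<tau>)"
  unfolding coordinate_pullback_def
proof (intro ballI impI)
  fix \<gamma> \<gamma>' i
  assume g: "\<gamma> \<in> cartesian_power \<Gamma> l" "\<gamma>' \<in> cartesian_power \<Gamma> l" and i: "i \<in> {1..l}"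
    and eq: "\<gamma> ((\<sigma> \<circ> \<tau>) i) = \<gamma>' ((\<sigma> \<circ> \<tau>) i)"
  have "\<tau> i \<in> {1..l}" using permutes_in_image[OF \<tau>] i by blast
  then have "w \<gamma> (\<tau> i) = w \<gamma>' (\<tau> i)"
    using w_pull[unfolded coordinate_pullback_def, rule_format, OF g, of "\<tau> i"] eq by simp
  then have "v (w \<gamma>) i = v (w \<gamma>') i"
    using v_pull[unfolded coordinate_pullback_def, rule_format,
        OF BijGroup_apply_in[OF w g(1)] BijGroup_apply_in[OF w g(2)] i] by blast
  then show "(v \<otimes>\<^bsub>BijGroup (cartesian_power \<Gamma> l)\<^esub> w) \<gamma> i = (v \<otimes>\<^bsub>BijGroup (cartesian_power \<Gamma> l)\<^esub> w) \<gamma>' i"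
    using g by (simp add: BijGroup_mult_apply v w)
qed

text \<open>
  If two different coordinates of the argument both determined the coordinate \<open>i\<close> of the value,
  then changing them one after the other would show that coordinate to be constant; but \<open>w\<close> is
  surjective.
\<close>

lemma coordinate_pullback_unique:
  assumes w: "w \<in> carrier (BijGroup (cartesian_power \<Gamma> l))" and "card \<Gamma> \<ge> 2"
    and \<sigma>: "\<sigma> permutes {1..l}" "coordinate_pullback \<Gamma> l w \<sigma>"
    and \<tau>: "\<tau> permutes {1..l}" "coordinate_pullback \<Gamma> l w \<tau>"
  shows "\<sigma> = \<tau>"
proof (rule ccontr)
  let ?P = "cartesian_power \<Gamma> l"
  assume "\<sigma> \<noteq> \<tau>"
  then obtain i where ne: "\<sigma> i \<noteq> \<tau> i" by auto
  then have i: "i \<in> {1..l}" using \<sigma>(1) \<tau>(1) by (metis permutes_not_in)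
  have const: "w \<gamma> i = w \<gamma>' i" if g: "\<gamma> \<in> ?P" "\<gamma>' \<in> ?P" for \<gamma> \<gamma>'
  proof -
    define \<delta> where "\<delta> = \<gamma>(\<tau> i := \<gamma>' (\<tau> i))"
    have "\<tau> i \<in> {1..l}" using permutes_in_image[OF \<tau>(1)] i by blast
    then have d: "\<delta> \<in> ?P"
      using g unfolding \<delta>_def cartesian_power_def by (auto simp: PiE_iff extensional_def)
    have "w \<gamma> i = w \<delta> i"
      using \<sigma>(2) g(1) d i ne unfolding coordinate_pullback_def \<delta>_def by (metis fun_upd_other)
    also have "\<dots> = w \<gamma>' i"
      using \<tau>(2) g(2) d i unfolding coordinate_pullback_def \<delta>_def by (metis fun_upd_same)
    finally show ?thesis .
  qed
  obtain a b where ab: "a \<in> \<Gamma>" "b \<in> \<Gamma>" "a \<noteq> b"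
    using \<open>card \<Gamma> \<ge> 2\<close> by (meson card_2_iff' obtain_subset_with_card_n subset_iff)
  have in_P: "(\<lambda>_\<in>{1..l}. c) \<in> ?P" if "c \<in> \<Gamma>" for c using that by (simp add: cartesian_power_def)
  interpret group "BijGroup ?P" by (rule group_BijGroup)
  have "c = w ((inv\<^bsub>BijGroup ?P\<^esub> w) (\<lambda>_\<in>{1..l}. c)) i" if "c \<in> \<Gamma>" for c
    using BijGroup_inv_apply(2)[OF w in_P[OF that]] i by simp
  then show False
    using const ab in_P BijGroup_apply_in[OF inv_closed[OF w]] by metis
qed

section \<open>The natural projections of a decomposition\<close>

lemma factor_mult_single:
  assumes "group G" "k \<ge> j" "j \<ge> 1" "t \<in> carrier G"
  shows "factor_mult G k (\<lambda>i\<in>{1..k}. if i = j then t else \<one>\<^bsub>G\<^esub>) = t"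
proof -
  interpret group G by fact
  have "foldr (\<lambda>i y. (\<lambda>i\<in>{1..k}. if i = j then t else \<one>\<^bsub>G\<^esub>) i \<otimes>\<^bsub>G\<^esub> y) xs \<one>\<^bsub>G\<^esub>
      = (if j \<in> set xs then t else \<one>\<^bsub>G\<^esub>)"
    if "distinct xs" "set xs \<subseteq> {1..k}" for xs
    using that
  proof (induction xs)
    case (Cons i xs)
    then show ?case using assms(4) by (cases "i = j") auto
  qed simp
  moreover have "set [1..<Suc k] = {1..k}" by auto
  moreover have "j \<in> {1..k}" using assms(2,3) by simp
  ultimately show ?thesis unfolding factor_mult_def by (metis distinct_upt subset_refl)
qed

lemma nonabelian_simple_product_natural_projection:
  assumes G: "group G" and fin: "finite (carrier G)" and dec: "nonabelian_simple_decomposition G k T"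
  shows "nonabelian_simple_product G {1..k} T (natural_projection G k T) (card (T 1))"
proof -
  interpret group G by (rule G)
  let ?P = "product_group {1..k} (\<lambda>i. G\<lparr>carrier := T i\<rparr>)"
  let ?\<psi> = "inv_into (carrier ?P) (factor_mult G k)"
  have sub: "subgroup (T i) G" if "i \<in> {1..k}" for i
    using dec that by (simp add: nonabelian_simple_decomposition_def internal_direct_product_def)
  have P: "group ?P" by (rule product_group) (rule subgroup_imp_group[OF sub])
  have iso: "factor_mult G k \<in> iso ?P G"
    using dec by (simp add: nonabelian_simple_decomposition_def internal_direct_product_def)
  then have bij: "bij_betw (factor_mult G k) (carrier ?P) (carrier G)" by (simp add: iso_def)
  have iso': "?\<psi> \<in> iso G ?P" using group.iso_set_sym[OF P iso] .
  then have hom: "?\<psi> \<in> hom G ?P" and bij': "bij_betw ?\<psi> (carrier G) (carrier ?P)"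
    by (simp_all add: iso_def)
  have p_eq: "natural_projection G k T i x = ?\<psi> x i" for i x
    by (simp add: natural_projection_def)
  have single: "natural_projection G k T i t = (if i = j then t else \<one>\<^bsub>G\<^esub>)"
    if i: "i \<in> {1..k}" and j: "j \<in> {1..k}" and t: "t \<in> T j" for i j t
  proof -
    let ?s = "\<lambda>i\<in>{1..k}. if i = j then t else \<one>\<^bsub>G\<^esub>"
    have s: "?s \<in> carrier ?P" using t subgroup.one_closed[OF sub] by auto
    have "factor_mult G k ?s = t"
      using factor_mult_single[OF G] j t subgroup.subset[OF sub[OF j]] by auto
    then have "?\<psi> t = ?s" using bij_betw_inv_into_left[OF bij s] by simp
    then show ?thesis using i by (simp add: p_eq)
  qed
  show ?thesis
  proof (intro nonabelian_simple_product.intro nonabelian_simple_product_axioms.intro G)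
    show "subgroup (T i) G" if "i \<in> {1..k}" for i using that by (rule sub)
    show in_T: "natural_projection G k T i x \<in> T i" if "i \<in> {1..k}" "x \<in> carrier G" for i x
    proof -
      have "?\<psi> x \<in> carrier ?P" using hom that(2) by (rule hom_in_carrier)
      then show ?thesis using that(1) by (auto simp: p_eq)
    qed
    show "natural_projection G k T i \<in> hom G G" if i: "i \<in> {1..k}" for i
    proof (rule homI)
      show "natural_projection G k T i x \<in> carrier G" if "x \<in> carrier G" for x
        using in_T[OF i that] subgroup.subset[OF sub[OF i]] by auto
      show "natural_projection G k T i (x \<otimes>\<^bsub>G\<^esub> y)
          = natural_projection G k T i x \<otimes>\<^bsub>G\<^esub> natural_projection G k T i y"
        if "x \<in> carrier G" "y \<in> carrier G" for x y
        using hom_mult[OF hom that] i by (simp add: p_eq)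
    qed
    show "natural_projection G k T i t = t" if "i \<in> {1..k}" "t \<in> T i" for i t
      using single[OF that(1) that] by simp
    show "natural_projection G k T i t = \<one>\<^bsub>G\<^esub>" if "i \<in> {1..k}" "j \<in> {1..k}" "i \<noteq> j" "t \<in> T j" for i j t
      using single[OF that(1,2,4)] that(3) by simp
    show "x = y" if x: "x \<in> carrier G" and y: "y \<in> carrier G"
      and eq: "\<And>i. i \<in> {1..k} \<Longrightarrow> natural_projection G k T i x = natural_projection G k T i y" for x y
    proof -
      have "?\<psi> x \<in> carrier ?P" "?\<psi> y \<in> carrier ?P" using hom_in_carrier[OF hom] x y by blast+
      then have "?\<psi> x = ?\<psi> y"
        unfolding carrier_product_group by (rule PiE_ext) (use eq in \<open>simp add: p_eq\<close>)
      then show "x = y" using bij_betw_imp_inj_on[OF bij'] x y by (simp add: inj_on_def)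
    qed
    show "simple_group (G\<lparr>carrier := T i\<rparr>)" "\<not> comm_group (G\<lparr>carrier := T i\<rparr>)" if "i \<in> {1..k}" for i
      using dec that by (simp_all add: nonabelian_simple_decomposition_def)
    show "card (T i) = card (T 1)" if "i \<in> {1..k}" for i
    proof -
      have "1 \<in> {1..k}" using that by auto
      then have "G\<lparr>carrier := T i\<rparr> \<cong> G\<lparr>carrier := T 1\<rparr>"
        using dec that unfolding nonabelian_simple_decomposition_def by blast
      then show ?thesis by (auto simp: is_iso_def iso_def dest: bij_betw_same_card)
    qed
  qed (use fin in auto)
qed

section \<open>Transitive minimal normal subgroups preserve the coordinates\<close>

locale product_action_minimal_normal =
  fixes \<Gamma> :: "'a set" and l :: nat and G M :: "((nat \<Rightarrow> 'a) \<Rightarrow> nat \<Rightarrow> 'a) set"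
  assumes finite_base: "finite \<Gamma>" and card_base: "card \<Gamma> \<ge> 2" and l_pos: "l \<ge> 1"
    and G_subgroup: "subgroup G (BijGroup (cartesian_power \<Gamma> l))"
    and G_wreath: "G \<subseteq> wreath_product_action \<Gamma> l"
    and M_minimal: "minimal_normal_subgroup M (perms (cartesian_power \<Gamma> l) G)"
    and M_transitive: "\<gamma> \<in> cartesian_power \<Gamma> l \<Longrightarrow> \<delta> \<in> cartesian_power \<Gamma> l \<Longrightarrow> \<exists>m\<in>M. m \<gamma> = \<delta>"
begin

abbreviation "P \<equiv> cartesian_power \<Gamma> l"
abbreviation "S \<equiv> BijGroup P"

sublocale group S by (rule group_BijGroup)

lemma G_carrier: "g \<in> G \<Longrightarrow> g \<in> carrier S"
  using subgroup.subset[OF G_subgroup] by blast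

lemma finite_P: "finite P"
  using finite_base by (simp add: cartesian_power_def finite_PiE)

lemma card_P: "card P = card \<Gamma> ^ l"
  using card_PiE[of "{1..l}" "\<lambda>_. \<Gamma>"] by (simp add: cartesian_power_def)

lemma const_in_P: "c \<in> \<Gamma> \<Longrightarrow> (\<lambda>_\<in>{1..l}. c) \<in> P"
  by (simp add: cartesian_power_def)

lemma P_coordinate: "\<gamma> \<in> P \<Longrightarrow> i \<in> {1..l} \<Longrightarrow> \<gamma> i \<in> \<Gamma>"
  unfolding cartesian_power_def by (rule PiE_mem)

lemma group_perms_G: "group (perms P G)"
  by (rule subgroup_imp_group[OF G_subgroup])

lemma M_normal: "M \<lhd> perms P G"
  using M_minimal by (simp add: minimal_normal_subgroup_def)

lemma M_in_G: "m \<in> M \<Longrightarrow> m \<in> G"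
  using subgroup.subset[OF normal_imp_subgroup[OF M_normal]] by auto

lemma M_subgroup: "subgroup M S"
  using incl_subgroup[OF G_subgroup normal_imp_subgroup[OF M_normal]] .

lemma M_carrier: "m \<in> M \<Longrightarrow> m \<in> carrier S"
  using M_in_G G_carrier by blast

lemma M_conj: "g \<in> G \<Longrightarrow> m \<in> M \<Longrightarrow> g \<otimes>\<^bsub>S\<^esub> m \<otimes>\<^bsub>S\<^esub> inv\<^bsub>S\<^esub> g \<in> M"
  using group.normal_invE(2)[OF group_perms_G M_normal, of g m] m_inv_consistent[OF G_subgroup, of g]
  by simp

lemma G_inv: "g \<in> G \<Longrightarrow> inv\<^bsub>S\<^esub> g \<in> G"
  using subgroup.m_inv_closed[OF G_subgroup] .

text \<open>Minimality in terms of subgroups of the full symmetric group that \<open>G\<close> normalises.\<close>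

lemma M_minimal_conj:
  assumes N: "subgroup N S" "N \<subseteq> M"
    and conj: "\<And>g x. g \<in> G \<Longrightarrow> x \<in> N \<Longrightarrow> g \<otimes>\<^bsub>S\<^esub> x \<otimes>\<^bsub>S\<^esub> inv\<^bsub>S\<^esub> g \<in> N"
  shows "N = {\<one>\<^bsub>S\<^esub>} \<or> N = M"
proof -
  have "N \<subseteq> G" using N(2) M_in_G by blast
  then have "subgroup N (perms P G)" using subgroup_incl[OF N(1) G_subgroup] by simp
  then have "N \<lhd> perms P G"
    using conj m_inv_consistent[OF G_subgroup] by (simp add: group.normal_inv_iff[OF group_perms_G])
  then show ?thesis using M_minimal N(2) by (simp add: minimal_normal_subgroup_def)
qed

lemma G_coordinate_pullback:
  assumes "g \<in> G" obtains \<sigma> where "\<sigma> permutes {1..l}" "coordinate_pullback \<Gamma> l g \<sigma>"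
  using wreath_coordinate_pullback G_wreath assms by blast

lemma pullback_one: "coordinate_pullback \<Gamma> l \<one>\<^bsub>S\<^esub> id"
  by (simp add: coordinate_pullback_def BijGroup_one_apply)

lemma pullback_unique:
  "g \<in> carrier S \<Longrightarrow> \<sigma> permutes {1..l} \<Longrightarrow> coordinate_pullback \<Gamma> l g \<sigma> \<Longrightarrow>
    \<tau> permutes {1..l} \<Longrightarrow> coordinate_pullback \<Gamma> l g \<tau> \<Longrightarrow> \<sigma> = \<tau>"
  using coordinate_pullback_unique[OF _ card_base] by blast

text \<open>The inverse lies in \<open>G\<close>, so it has some top component; uniqueness for \<open>\<one>\<close> identifies it.\<close>

lemma pullback_inv:
  assumes g: "g \<in> G" and \<sigma>: "\<sigma> permutes {1..l}" "coordinate_pullback \<Gamma> l g \<sigma>"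
  shows "coordinate_pullback \<Gamma> l (inv\<^bsub>S\<^esub> g) (inv_into UNIV \<sigma>)"
proof -
  obtain \<tau> where \<tau>: "\<tau> permutes {1..l}" "coordinate_pullback \<Gamma> l (inv\<^bsub>S\<^esub> g) \<tau>"
    by (rule G_coordinate_pullback[OF G_inv[OF g]])
  have gS: "g \<in> carrier S" by (rule G_carrier[OF g])
  have "coordinate_pullback \<Gamma> l \<one>\<^bsub>S\<^esub> (\<tau> \<circ> \<sigma>)"
    using coordinate_pullback_mult[OF gS inv_closed[OF gS] \<sigma>(2) \<tau>(2) \<sigma>(1)] gS by simp
  then have "\<tau> \<circ> \<sigma> = id"
    by (rule pullback_unique[OF one_closed permutes_compose[OF \<sigma>(1) \<tau>(1)] _ permutes_id pullback_one])
  then have "inv_into UNIV \<sigma> = \<tau>"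
    by (rule inv_unique_comp[rotated])
      (use \<open>\<tau> \<circ> \<sigma> = id\<close> permutes_inv_o(1)[OF \<sigma>(1)] in \<open>metis comp_assoc comp_id id_comp\<close>)
  then show ?thesis using \<tau>(2) by simp
qed

lemma M_apply_in: "m \<in> M \<Longrightarrow> \<gamma> \<in> P \<Longrightarrow> m \<gamma> \<in> P"
  using BijGroup_apply_in[OF M_carrier] .

lemma M_inv_mult_apply:
  "x \<in> M \<Longrightarrow> y \<in> M \<Longrightarrow> \<gamma> \<in> P \<Longrightarrow> (inv\<^bsub>S\<^esub> x \<otimes>\<^bsub>S\<^esub> y) \<gamma> = (inv\<^bsub>S\<^esub> x) (y \<gamma>)"
  by (rule BijGroup_mult_apply[OF inv_closed[OF M_carrier] M_carrier])

lemma M_inv_mult_in: "x \<in> M \<Longrightarrow> y \<in> M \<Longrightarrow> inv\<^bsub>S\<^esub> x \<otimes>\<^bsub>S\<^esub> y \<in> M"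
  using subgroup.m_closed[OF M_subgroup subgroup.m_inv_closed[OF M_subgroup]] .

lemma card_M_fibres:
  assumes H: "subgroup H S" "H \<subseteq> M" and surj: "f ` M = Y"
    and fib: "\<And>x y. x \<in> M \<Longrightarrow> y \<in> M \<Longrightarrow> f x = f y \<longleftrightarrow> inv\<^bsub>S\<^esub> x \<otimes>\<^bsub>S\<^esub> y \<in> H"
  shows "card M = card Y * card H"
proof -
  have "finite M" using finite_subset[OF _ finite_BijGroup[OF finite_P]] M_carrier by blast
  then show ?thesis
    using group.card_eq_card_fibres_mult[OF subgroup_imp_group[OF M_subgroup], of H f Y]
      subgroup_incl[OF H(1) M_subgroup H(2)] surj fib m_inv_consistent[OF M_subgroup] by simp
qed

lemma M_stabilizer_subgroup:
  assumes "\<omega> \<in> P" shows "subgroup {m \<in> M. m \<omega> = \<omega>} S"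
proof (rule subgroupI)
  show "{m \<in> M. m \<omega> = \<omega>} \<subseteq> carrier S" using M_carrier by blast
  show "{m \<in> M. m \<omega> = \<omega>} \<noteq> {}"
    using subgroup.one_closed[OF M_subgroup] BijGroup_one_apply[OF assms] by blast
  show "inv\<^bsub>S\<^esub> a \<in> {m \<in> M. m \<omega> = \<omega>}" if "a \<in> {m \<in> M. m \<omega> = \<omega>}" for a
    using that subgroup.m_inv_closed[OF M_subgroup, of a]
      BijGroup_inv_apply(1)[OF M_carrier assms, of a] by auto
  show "a \<otimes>\<^bsub>S\<^esub> b \<in> {m \<in> M. m \<omega> = \<omega>}"
    if "a \<in> {m \<in> M. m \<omega> = \<omega>}" "b \<in> {m \<in> M. m \<omega> = \<omega>}" for a b
    using that subgroup.m_closed[OF M_subgroup, of a b]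
      BijGroup_mult_apply[OF M_carrier M_carrier assms, of a b] by auto
qed

lemma card_M_P:
  assumes \<omega>: "\<omega> \<in> P"
  shows "card M = card \<Gamma> ^ l * card {m \<in> M. m \<omega> = \<omega>}"
  unfolding card_P[symmetric]
proof (rule card_M_fibres[where f = "\<lambda>m. m \<omega>"])
  show "(\<lambda>m. m \<omega>) ` M = P"
    using M_transitive[OF \<omega>] M_apply_in[OF _ \<omega>] by blast
  show "x \<omega> = y \<omega> \<longleftrightarrow> inv\<^bsub>S\<^esub> x \<otimes>\<^bsub>S\<^esub> y \<in> {m \<in> M. m \<omega> = \<omega>}" if "x \<in> M" "y \<in> M" for x y
    using M_inv_mult_in[OF that] M_inv_mult_apply[OF that \<omega>]
      BijGroup_inv_apply(1)[OF M_carrier[OF that(1)] \<omega>]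
      BijGroup_inv_apply(2)[OF M_carrier[OF that(1)] M_apply_in[OF that(2) \<omega>]] by auto
qed (use M_stabilizer_subgroup[OF \<omega>] in auto)

text \<open>
  The elements of \<open>M\<close> with trivial top component form a subgroup normalised by \<open>G\<close>. If it were
  trivial, \<open>M\<close> would be anti-isomorphic to a subgroup of \<open>S\<^sub>l\<close>, so its order would divide \<open>l!\<close>,
  although it is divisible by \<open>|\<Gamma>|\<^sup>l\<close>.
\<close>

lemma M_preserves_coordinates:
  assumes "m \<in> M" shows "coordinate_pullback \<Gamma> l m id"
proof -
  let ?N = "{m \<in> M. coordinate_pullback \<Gamma> l m id}"
  have N: "subgroup ?N S"
  proof (rule subgroupI)
    show "?N \<subseteq> carrier S" using M_carrier by blast
    have "\<one>\<^bsub>S\<^esub> \<in> ?N" using pullback_one subgroup.one_closed[OF M_subgroup] by blast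
    then show "?N \<noteq> {}" by blast
    show "inv\<^bsub>S\<^esub> a \<in> ?N" if "a \<in> ?N" for a
      using that pullback_inv[OF M_in_G permutes_id, of a] subgroup.m_inv_closed[OF M_subgroup, of a]
      by (simp add: inv_id)
    show "a \<otimes>\<^bsub>S\<^esub> b \<in> ?N" if "a \<in> ?N" "b \<in> ?N" for a b
      using that coordinate_pullback_mult[OF M_carrier M_carrier _ _ permutes_id, of a b id]
        subgroup.m_closed[OF M_subgroup, of a b] by simp
  qed
  have "g \<otimes>\<^bsub>S\<^esub> a \<otimes>\<^bsub>S\<^esub> inv\<^bsub>S\<^esub> g \<in> ?N" if g: "g \<in> G" and a: "a \<in> ?N" for g a
  proof -
    obtain \<sigma> where \<sigma>: "\<sigma> permutes {1..l}" "coordinate_pullback \<Gamma> l g \<sigma>"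
      by (rule G_coordinate_pullback[OF g])
    have gS: "g \<in> carrier S" and aS: "a \<in> carrier S" using G_carrier[OF g] M_carrier a by auto
    have "coordinate_pullback \<Gamma> l (g \<otimes>\<^bsub>S\<^esub> a) (id \<circ> \<sigma>)"
      using coordinate_pullback_mult[OF gS aS \<sigma>(2) _ \<sigma>(1)] a by blast
    then have "coordinate_pullback \<Gamma> l (g \<otimes>\<^bsub>S\<^esub> a \<otimes>\<^bsub>S\<^esub> inv\<^bsub>S\<^esub> g) (inv_into UNIV \<sigma> \<circ> \<sigma>)"
      using coordinate_pullback_mult[OF _ inv_closed[OF gS] _ pullback_inv[OF g \<sigma>] \<sigma>(1)] gS aS by simp
    then show ?thesis using M_conj[OF g] a permutes_inv_o(2)[OF \<sigma>(1)] by simp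
  qed
  then have "?N = {\<one>\<^bsub>S\<^esub>} \<or> ?N = M" by (intro M_minimal_conj N) auto
  then show ?thesis
  proof
    assume "?N = M" then show ?thesis using assms by blast
  next
    assume triv: "?N = {\<one>\<^bsub>S\<^esub>}"
    define top where "top = (\<lambda>m. SOME \<sigma>. \<sigma> permutes {1..l} \<and> coordinate_pullback \<Gamma> l m \<sigma>)"
    have top: "top m permutes {1..l}" "coordinate_pullback \<Gamma> l m (top m)" if m: "m \<in> M" for m
    proof -
      obtain \<sigma> where "\<sigma> permutes {1..l} \<and> coordinate_pullback \<Gamma> l m \<sigma>"
        using G_coordinate_pullback[OF M_in_G[OF m]] by blast
      then have "top m permutes {1..l} \<and> coordinate_pullback \<Gamma> l m (top m)"
        unfolding top_def
        by (rule someI[of "\<lambda>\<sigma>. \<sigma> permutes {1..l} \<and> coordinate_pullback \<Gamma> l m \<sigma>"])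
      then show "top m permutes {1..l}" "coordinate_pullback \<Gamma> l m (top m)" by simp_all
    qed
    have top_eq: "top m = \<sigma>" if "m \<in> M" "\<sigma> permutes {1..l}" "coordinate_pullback \<Gamma> l m \<sigma>" for m \<sigma>
      using pullback_unique[OF M_carrier[OF that(1)] top[OF that(1)] that(2,3)] .
    have top_mult: "top (a \<otimes>\<^bsub>S\<^esub> b) = top b \<circ> top a" if "a \<in> M" "b \<in> M" for a b
      using top_eq[OF subgroup.m_closed[OF M_subgroup that]] top[OF that(1)] top[OF that(2)]
        coordinate_pullback_mult[OF M_carrier[OF that(1)] M_carrier[OF that(2)]] permutes_compose by blast
    have top_inv: "top (inv\<^bsub>S\<^esub> a) = inv_into UNIV (top a)" if "a \<in> M" for a
      using top_eq[OF subgroup.m_inv_closed[OF M_subgroup that] permutes_inv[OF top(1)[OF that]]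
          pullback_inv[OF M_in_G[OF that] top[OF that]]] .
    have inj: "inj_on top M"
    proof (rule inj_onI)
      fix a b assume ab: "a \<in> M" "b \<in> M" "top a = top b"
      let ?c = "inv\<^bsub>S\<^esub> a \<otimes>\<^bsub>S\<^esub> b"
      have ia: "inv\<^bsub>S\<^esub> a \<in> M" using subgroup.m_inv_closed[OF M_subgroup ab(1)] .
      have c: "?c \<in> M" using subgroup.m_closed[OF M_subgroup ia ab(2)] .
      have "top ?c = id"
        using top_mult[OF ia ab(2)] top_inv[OF ab(1)] ab(3) permutes_inv_o(1)[OF top(1)[OF ab(2)]] by simp
      then have "?c \<in> ?N" using top(2)[OF c] c by simp
      then have "?c = \<one>\<^bsub>S\<^esub>" using triv by blast
      then show "a = b" using M_carrier[OF ab(1)] M_carrier[OF ab(2)]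
        by (metis inv_closed inv_equality inv_inv)
    qed
    interpret Sym: group "sym_group l" by (rule sym_group_is_group)
    have "subgroup (top ` M) (sym_group l)"
    proof (rule Sym.subgroupI)
      show "top ` M \<subseteq> carrier (sym_group l)" using top(1) by (auto simp: sym_group_carrier)
      show "top ` M \<noteq> {}" using assms by blast
      show "inv\<^bsub>sym_group l\<^esub> s \<in> top ` M" if s: "s \<in> top ` M" for s
      proof -
        obtain a where a: "a \<in> M" "s = top a" using s by blast
        have "inv\<^bsub>sym_group l\<^esub> s = inv_into UNIV s"
          using sym_group_inv_equality[of s l] top(1)[OF a(1)] a(2) by (simp add: sym_group_carrier)
        then show ?thesis using top_inv[OF a(1)] subgroup.m_inv_closed[OF M_subgroup a(1)] a(2) by (metis imageI)
      qed
      show "s \<otimes>\<^bsub>sym_group l\<^esub> t \<in> top ` M" if s: "s \<in> top ` M" and t: "t \<in> top ` M" for s t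
      proof -
        obtain a b where "a \<in> M" "s = top a" "b \<in> M" "t = top b" using s t by blast
        then have "s \<otimes>\<^bsub>sym_group l\<^esub> t = top (b \<otimes>\<^bsub>S\<^esub> a)" "b \<otimes>\<^bsub>S\<^esub> a \<in> M"
          using top_mult[of b a] subgroup.m_closed[OF M_subgroup, of b a] by (simp_all add: sym_group_mult)
        then show ?thesis by blast
      qed
    qed
    from Sym.lagrange[OF this] have "card (top ` M) dvd order (sym_group l)" by (metis dvd_triv_right)
    moreover have "order (sym_group l) = fact l"
      using card_permutations[of "{1..l}" l] by (simp add: order_def sym_group_def)
    ultimately have "card M dvd fact l" using card_image[OF inj] by simp
    moreover obtain c where c: "c \<in> \<Gamma>" using card_base by fastforce
    have "card \<Gamma> ^ l dvd card M"
      unfolding card_M_P[OF const_in_P[OF c]] by (rule dvd_triv_left)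
    ultimately have "card \<Gamma> ^ l dvd fact l" using dvd_trans by blast
    then show ?thesis using power_self_not_dvd_fact[OF card_base l_pos] by blast
  qed
qed

end

section \<open>Coordinates moved by the simple factors\<close>

context product_action_minimal_normal
begin

definition moved :: "((nat \<Rightarrow> 'a) \<Rightarrow> nat \<Rightarrow> 'a) set \<Rightarrow> nat set" where
  "moved N = {i \<in> {1..l}. \<exists>t\<in>N. \<exists>\<gamma>\<in>P. t \<gamma> i \<noteq> \<gamma> i}"

abbreviation conj_by :: "((nat \<Rightarrow> 'a) \<Rightarrow> nat \<Rightarrow> 'a) \<Rightarrow> ((nat \<Rightarrow> 'a) \<Rightarrow> nat \<Rightarrow> 'a) \<Rightarrow> (nat \<Rightarrow> 'a) \<Rightarrow> nat \<Rightarrow> 'a" where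
  "conj_by g t \<equiv> g \<otimes>\<^bsub>S\<^esub> t \<otimes>\<^bsub>S\<^esub> inv\<^bsub>S\<^esub> g"

lemma inv_mult_cancel: "g \<in> carrier S \<Longrightarrow> x \<in> carrier S \<Longrightarrow> inv\<^bsub>S\<^esub> g \<otimes>\<^bsub>S\<^esub> (g \<otimes>\<^bsub>S\<^esub> x) = x"
  by (simp add: m_assoc[symmetric])

lemma conj_by_mult:
  "g \<in> carrier S \<Longrightarrow> s \<in> carrier S \<Longrightarrow> t \<in> carrier S \<Longrightarrow>
    conj_by g (s \<otimes>\<^bsub>S\<^esub> t) = conj_by g s \<otimes>\<^bsub>S\<^esub> conj_by g t"
  by (simp add: m_assoc inv_mult_cancel)

lemma conj_by_inv: "g \<in> carrier S \<Longrightarrow> t \<in> carrier S \<Longrightarrow> conj_by (inv\<^bsub>S\<^esub> g) (conj_by g t) = t"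
  by (simp add: m_assoc inv_mult_cancel)

lemma conj_by_comp:
  "g \<in> carrier S \<Longrightarrow> h \<in> carrier S \<Longrightarrow> t \<in> carrier S \<Longrightarrow>
    conj_by g (conj_by h t) = conj_by (g \<otimes>\<^bsub>S\<^esub> h) t"
  by (simp add: m_assoc inv_mult_group)

text \<open>The top component of \<open>g\<close> maps the coordinates moved by the conjugate into those moved by \<open>N\<close>.\<close>

lemma card_moved_conj_le:
  assumes g: "g \<in> G" and N: "N \<subseteq> carrier S"
  shows "card (moved (conj_by g ` N)) \<le> card (moved N)"
proof -
  obtain \<sigma> where \<sigma>: "\<sigma> permutes {1..l}" "coordinate_pullback \<Gamma> l g \<sigma>"
    by (rule G_coordinate_pullback[OF g])
  have gS: "g \<in> carrier S" by (rule G_carrier[OF g])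
  have "\<sigma> i \<in> moved N" if i: "i \<in> moved (conj_by g ` N)" for i
  proof (rule ccontr)
    assume not: "\<sigma> i \<notin> moved N"
    from i obtain t \<gamma> where t: "t \<in> N" and \<gamma>: "\<gamma> \<in> P" and il: "i \<in> {1..l}"
      and ne: "conj_by g t \<gamma> i \<noteq> \<gamma> i" by (auto simp: moved_def)
    have tS: "t \<in> carrier S" using t N by blast
    let ?\<delta> = "(inv\<^bsub>S\<^esub> g) \<gamma>"
    have \<delta>: "?\<delta> \<in> P" by (rule BijGroup_apply_in[OF inv_closed[OF gS] \<gamma>])
    have "conj_by g t \<gamma> = g (t ?\<delta>)"
      using gS tS \<gamma> \<delta> by (simp add: BijGroup_mult_apply)
    moreover have "\<sigma> i \<in> {1..l}" using permutes_in_image[OF \<sigma>(1)] il by blast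
    then have "t ?\<delta> (\<sigma> i) = ?\<delta> (\<sigma> i)" using not t \<delta> by (auto simp: moved_def)
    then have "g (t ?\<delta>) i = g ?\<delta> i"
      using \<sigma>(2)[unfolded coordinate_pullback_def, rule_format, OF BijGroup_apply_in[OF tS \<delta>] \<delta> il] by blast
    moreover have "g ?\<delta> = \<gamma>" by (rule BijGroup_inv_apply(2)[OF gS \<gamma>])
    ultimately show False using ne by simp
  qed
  moreover have "inj \<sigma>" using permutes_inj[OF \<sigma>(1)] .
  moreover have "finite (moved N)" by (simp add: moved_def)
  ultimately show ?thesis by (intro card_inj_on_le[of \<sigma>]) (auto intro: inj_on_subset)
qed

lemma M_coordinate_cong:
  "m \<in> M \<Longrightarrow> \<gamma> \<in> P \<Longrightarrow> \<delta> \<in> P \<Longrightarrow> i \<in> {1..l} \<Longrightarrow> \<gamma> i = \<delta> i \<Longrightarrow> m \<gamma> i = m \<delta> i"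
  using M_preserves_coordinates[unfolded coordinate_pullback_def, rule_format, of m \<gamma> \<delta> i] by simp

text \<open>
  By transitivity of \<open>M\<close>, a subgroup normalised by \<open>M\<close> that moves the coordinate \<open>i\<close> of some
  point also moves the coordinate \<open>i\<close> of \<open>\<omega>\<close>.
\<close>

lemma moved_normal_iff:
  assumes N: "N \<subseteq> M" "\<And>m t. m \<in> M \<Longrightarrow> t \<in> N \<Longrightarrow> inv\<^bsub>S\<^esub> m \<otimes>\<^bsub>S\<^esub> t \<otimes>\<^bsub>S\<^esub> m \<in> N"
    and \<omega>: "\<omega> \<in> P" and i: "i \<in> {1..l}"
  shows "i \<in> moved N \<longleftrightarrow> \<not> N \<subseteq> {m \<in> M. m \<omega> i = \<omega> i}"
proof
  assume "i \<in> moved N"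
  then obtain t \<gamma> where t: "t \<in> N" and \<gamma>: "\<gamma> \<in> P" and ne: "t \<gamma> i \<noteq> \<gamma> i" by (auto simp: moved_def)
  obtain m where m: "m \<in> M" "m \<omega> = \<gamma>" using M_transitive[OF \<omega> \<gamma>] by blast
  let ?t = "inv\<^bsub>S\<^esub> m \<otimes>\<^bsub>S\<^esub> t \<otimes>\<^bsub>S\<^esub> m"
  have mS: "m \<in> carrier S" and tM: "t \<in> M" using m t N(1) M_carrier by auto
  have tS: "t \<in> carrier S" using M_carrier[OF tM] .
  have tN: "?t \<in> N" by (rule N(2)[OF m(1) t])
  then have tM': "?t \<in> M" using N(1) by blast
  have "m \<otimes>\<^bsub>S\<^esub> ?t = t \<otimes>\<^bsub>S\<^esub> m" using mS tS by (simp add: m_assoc[symmetric])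
  then have "m (?t \<omega>) = t \<gamma>"
    using BijGroup_mult_apply[OF mS M_carrier[OF tM'] \<omega>] BijGroup_mult_apply[OF tS mS \<omega>] m(2) by simp
  then have "?t \<omega> i \<noteq> \<omega> i"
    using M_coordinate_cong[OF m(1) M_apply_in[OF tM' \<omega>] \<omega> i] ne m(2) by auto
  then show "\<not> N \<subseteq> {m \<in> M. m \<omega> i = \<omega> i}" using tN by blast
qed (use \<omega> i N(1) in \<open>auto simp: moved_def\<close>)

lemma coordinate_stabilizer_subgroup:
  assumes \<omega>: "\<omega> \<in> P" and i: "i \<in> {1..l}"
  shows "subgroup {m \<in> M. m \<omega> i = \<omega> i} S"
proof (rule subgroupI)
  show "{m \<in> M. m \<omega> i = \<omega> i} \<subseteq> carrier S" using M_carrier by blast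
  show "{m \<in> M. m \<omega> i = \<omega> i} \<noteq> {}"
    using subgroup.one_closed[OF M_subgroup] BijGroup_one_apply[OF \<omega>] by force
  show "inv\<^bsub>S\<^esub> a \<in> {m \<in> M. m \<omega> i = \<omega> i}" if "a \<in> {m \<in> M. m \<omega> i = \<omega> i}" for a
  proof -
    have a: "a \<in> M" "a \<omega> i = \<omega> i" using that by auto
    have ia: "inv\<^bsub>S\<^esub> a \<in> M" using subgroup.m_inv_closed[OF M_subgroup a(1)] .
    show ?thesis
      using M_coordinate_cong[OF ia M_apply_in[OF a(1) \<omega>] \<omega> i a(2)]
        BijGroup_inv_apply(1)[OF M_carrier[OF a(1)] \<omega>] ia by simp
  qed
  show "a \<otimes>\<^bsub>S\<^esub> b \<in> {m \<in> M. m \<omega> i = \<omega> i}"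
    if "a \<in> {m \<in> M. m \<omega> i = \<omega> i}" "b \<in> {m \<in> M. m \<omega> i = \<omega> i}" for a b
  proof -
    have ab: "a \<in> M" "a \<omega> i = \<omega> i" "b \<in> M" "b \<omega> i = \<omega> i" using that by auto
    then show ?thesis
      using M_coordinate_cong[OF ab(1) M_apply_in[OF ab(3) \<omega>] \<omega> i ab(4)]
        BijGroup_mult_apply[OF M_carrier M_carrier \<omega>, of a b] subgroup.m_closed[OF M_subgroup ab(1,3)] by simp
  qed
qed

lemma card_M_coordinate:
  assumes \<omega>: "\<omega> \<in> P" and i: "i \<in> {1..l}"
  shows "card M = card \<Gamma> * card {m \<in> M. m \<omega> i = \<omega> i}"
proof (rule card_M_fibres[where f = "\<lambda>m. m \<omega> i"])
  show "(\<lambda>m. m \<omega> i) ` M = \<Gamma>"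
  proof
    show "(\<lambda>m. m \<omega> i) ` M \<subseteq> \<Gamma>" using P_coordinate[OF M_apply_in[OF _ \<omega>] i] by blast
    show "\<Gamma> \<subseteq> (\<lambda>m. m \<omega> i) ` M"
    proof
      fix c assume "c \<in> \<Gamma>"
      then obtain m where "m \<in> M" "m \<omega> = (\<lambda>_\<in>{1..l}. c)"
        using M_transitive[OF \<omega> const_in_P] by blast
      then show "c \<in> (\<lambda>m. m \<omega> i) ` M" using i by (intro image_eqI[of _ _ m]) simp_all
    qed
  qed
  show "x \<omega> i = y \<omega> i \<longleftrightarrow> inv\<^bsub>S\<^esub> x \<otimes>\<^bsub>S\<^esub> y \<in> {m \<in> M. m \<omega> i = \<omega> i}" if x: "x \<in> M" and y: "y \<in> M" for x y
  proof -
    let ?x' = "inv\<^bsub>S\<^esub> x"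
    have x': "?x' \<in> M" using subgroup.m_inv_closed[OF M_subgroup x] .
    have xw: "x \<omega> \<in> P" and yw: "y \<omega> \<in> P" using M_apply_in x y \<omega> by blast+
    have x'yw: "?x' (y \<omega>) \<in> P" using M_apply_in[OF x' yw] .
    have "?x' (x \<omega>) = \<omega>" "x (?x' (y \<omega>)) = y \<omega>"
      using BijGroup_inv_apply[OF M_carrier[OF x]] \<omega> yw by blast+
    then have "x \<omega> i = y \<omega> i \<longleftrightarrow> ?x' (y \<omega>) i = \<omega> i"
      using M_coordinate_cong[OF x' xw yw i] M_coordinate_cong[OF x x'yw \<omega> i] by auto
    then show ?thesis using M_inv_mult_in[OF x y] M_inv_mult_apply[OF x y \<omega>] by simp
  qed
qed (use coordinate_stabilizer_subgroup[OF assms] in auto)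

end

locale product_action_plinth = product_action_minimal_normal +
  fixes k :: nat and T p q
  assumes factors: "nonabelian_simple_product (perms (cartesian_power \<Gamma> l) M) {1..k} T p q"
begin

sublocale M: nonabelian_simple_product "perms P M" "{1..k}" T p q by (rule factors)

lemma factor_in_M: "j \<in> {1..k} \<Longrightarrow> T j \<subseteq> M"
  using M.factor_sub by simp

lemma inv_perms_M: "m \<in> M \<Longrightarrow> inv\<^bsub>perms P M\<^esub> m = inv\<^bsub>S\<^esub> m"
  using m_inv_consistent[OF M_subgroup] .

lemma M_subgroup_iff: "H \<subseteq> M \<Longrightarrow> subgroup H (perms P M) \<longleftrightarrow> subgroup H S"
  using subgroup_incl[OF _ M_subgroup] incl_subgroup[OF M_subgroup] by blast

lemma factor_normal:
  assumes "j \<in> {1..k}" "m \<in> M" "t \<in> T j"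
  shows "conj_by m t \<in> T j"
  using M.subproduct_conj[of t "{j}" m, unfolded M.subproduct_singleton[OF assms(1)]] assms(2,3)
    inv_perms_M[of m] by simp

text \<open>
  The conjugate of a factor is a non-trivial normal subgroup of \<open>M\<close>, hence contains a factor, and
  it has the same order as that factor.
\<close>

lemma conj_by_factor:
  assumes g: "g \<in> G" and j: "j \<in> {1..k}"
  obtains j' where "j' \<in> {1..k}" "conj_by g ` T j = T j'"
proof -
  let ?N = "conj_by g ` T j"
  have gS: "g \<in> carrier S" by (rule G_carrier[OF g])
  have TS: "t \<in> carrier S" if "t \<in> T j" for t using factor_in_M[OF j] M_carrier that by blast
  have Tsub: "subgroup (T j) S"
    using M.factor_subgroup[OF j] M_subgroup_iff[OF factor_in_M[OF j]] by simp
  have hom: "group_hom S S (conj_by g)"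
    by (unfold_locales, rule homI) (use gS conj_by_mult in auto)
  have NM: "?N \<subseteq> M" using M_conj[OF g] factor_in_M[OF j] by blast
  have Nsub: "subgroup ?N S" using group_hom.subgroup_img_is_subgroup[OF hom Tsub] .
  have inj: "inj_on (conj_by g) (T j)"
    by (rule inj_on_inverseI[where g = "conj_by (inv\<^bsub>S\<^esub> g)"]) (rule conj_by_inv[OF gS TS])
  have "conj_by m x \<in> ?N" if m: "m \<in> M" and x: "x \<in> ?N" for m x
  proof -
    obtain t where t: "t \<in> T j" "x = conj_by g t" using x by blast
    let ?m = "conj_by (inv\<^bsub>S\<^esub> g) m"
    have mS: "m \<in> carrier S" using M_carrier[OF m] .
    have m': "?m \<in> M" using M_conj[OF G_inv[OF g] m] .
    have "m \<otimes>\<^bsub>S\<^esub> g = g \<otimes>\<^bsub>S\<^esub> ?m" using gS mS by (simp add: m_assoc[symmetric])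
    then have "conj_by m x = conj_by g (conj_by ?m t)"
      using t(2) conj_by_comp[OF mS gS TS[OF t(1)]] conj_by_comp[OF gS M_carrier[OF m'] TS[OF t(1)]] by simp
    then show ?thesis using factor_normal[OF j m' t(1)] by blast
  qed
  then have "?N \<lhd> perms P M"
    using Nsub M_subgroup_iff[OF NM] inv_perms_M by (simp add: M.normal_inv_iff)
  moreover have "?N \<noteq> {\<one>\<^bsub>perms P M\<^esub>}"
  proof
    assume "?N = {\<one>\<^bsub>perms P M\<^esub>}"
    then have "card ?N = 1" by simp
    then show False using card_image[OF inj] M.card_factor[OF j] M.q_ge_2[OF j] by simp
  qed
  ultimately obtain j' where j': "j' \<in> {1..k}" "T j' \<subseteq> ?N"
    by (rule M.normal_subgroup_contains_factor)
  have "finite ?N" using M.finite_carrier NM by (auto intro: finite_subset)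
  moreover have "card (T j') = card ?N" using card_image[OF inj] M.card_factor j j'(1) by simp
  ultimately have "T j' = ?N" using card_subset_eq j'(2) by blast
  then show thesis using that j'(1) by blast
qed

lemma factors_commute:
  assumes "j \<in> {1..k}" "j' \<in> {1..k}" "j \<noteq> j'" "s \<in> T j" "t \<in> T j'"
  shows "s \<otimes>\<^bsub>S\<^esub> t = t \<otimes>\<^bsub>S\<^esub> s"
proof -
  have sM: "s \<in> carrier (perms P M)" and tM: "t \<in> carrier (perms P M)"
    using assms factor_in_M by auto
  have "s \<otimes>\<^bsub>perms P M\<^esub> t = t \<otimes>\<^bsub>perms P M\<^esub> s"
  proof (rule M.proj_ext)
    fix i assume i: "i \<in> {1..k}"
    have "p i s = \<one>\<^bsub>perms P M\<^esub> \<or> p i t = \<one>\<^bsub>perms P M\<^esub>"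
      using M.proj_other_factor[OF i] assms by metis
    then show "p i (s \<otimes>\<^bsub>perms P M\<^esub> t) = p i (t \<otimes>\<^bsub>perms P M\<^esub> s)"
      using M.proj_mult[OF i sM tM] M.proj_mult[OF i tM sM] M.proj_carrier[OF i sM] M.proj_carrier[OF i tM]
        M.l_one M.r_one by metis
  qed (use sM tM M.m_closed in blast)+
  then show ?thesis by simp
qed

text \<open>
  All factors move equally many coordinates. Otherwise let \<open>B\<close> be the set of factors moving more
  coordinates than \<open>T j0\<close> does. Since \<open>G\<close> permutes the factors in \<open>B\<close>, it normalises their
  centraliser \<open>C\<close> in \<open>M\<close>. But \<open>C\<close> contains \<open>T j0\<close>, so it is all of \<open>M\<close> by minimality, and the
  factors in \<open>B\<close> would be abelian.
\<close>

lemma card_moved_factor_le: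
  assumes j0: "j0 \<in> {1..k}" and j: "j \<in> {1..k}"
  shows "card (moved (T j)) \<le> card (moved (T j0))"
proof (rule ccontr)
  assume gt: "\<not> card (moved (T j)) \<le> card (moved (T j0))"
  define B where "B = {j \<in> {1..k}. card (moved (T j)) > card (moved (T j0))}"
  define C where "C = {m \<in> M. \<forall>j\<in>B. \<forall>t\<in>T j. m \<otimes>\<^bsub>S\<^esub> t = t \<otimes>\<^bsub>S\<^esub> m}"
  have BI: "j \<in> {1..k}" if "j \<in> B" for j using that by (simp add: B_def)
  have TS: "t \<in> carrier S" if "j \<in> {1..k}" "t \<in> T j" for j t
    using factor_in_M M_carrier that by blast
  have Csub: "subgroup C S"
  proof (rule subgroupI)
    show "C \<subseteq> carrier S" using M_carrier by (auto simp: C_def)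
    have "\<one>\<^bsub>S\<^esub> \<otimes>\<^bsub>S\<^esub> t = t \<otimes>\<^bsub>S\<^esub> \<one>\<^bsub>S\<^esub>" if "j \<in> B" "t \<in> T j" for j t
      using TS[OF BI[OF that(1)] that(2)] by simp
    then have "\<one>\<^bsub>S\<^esub> \<in> C" using subgroup.one_closed[OF M_subgroup] by (simp add: C_def)
    then show "C \<noteq> {}" by blast
    show "inv\<^bsub>S\<^esub> a \<in> C" if a: "a \<in> C" for a
    proof -
      have aM: "a \<in> M" using a by (simp add: C_def)
      have "inv\<^bsub>S\<^esub> a \<otimes>\<^bsub>S\<^esub> t = t \<otimes>\<^bsub>S\<^esub> inv\<^bsub>S\<^esub> a" if jt: "j \<in> B" "t \<in> T j" for j t
      proof -
        have t: "t \<in> carrier S" using TS BI jt by blast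
        have aS: "a \<in> carrier S" using M_carrier aM by blast
        have "inv\<^bsub>S\<^esub> a \<otimes>\<^bsub>S\<^esub> (a \<otimes>\<^bsub>S\<^esub> t) \<otimes>\<^bsub>S\<^esub> inv\<^bsub>S\<^esub> a = inv\<^bsub>S\<^esub> a \<otimes>\<^bsub>S\<^esub> (t \<otimes>\<^bsub>S\<^esub> a) \<otimes>\<^bsub>S\<^esub> inv\<^bsub>S\<^esub> a"
          using a jt by (simp add: C_def)
        moreover have "inv\<^bsub>S\<^esub> a \<otimes>\<^bsub>S\<^esub> (a \<otimes>\<^bsub>S\<^esub> t) = t" using aS t by (simp add: m_assoc[symmetric])
        moreover have "inv\<^bsub>S\<^esub> a \<otimes>\<^bsub>S\<^esub> (t \<otimes>\<^bsub>S\<^esub> a) \<otimes>\<^bsub>S\<^esub> inv\<^bsub>S\<^esub> a = inv\<^bsub>S\<^esub> a \<otimes>\<^bsub>S\<^esub> t"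
          using aS t by (simp add: m_assoc)
        ultimately show ?thesis by simp
      qed
      then show ?thesis using subgroup.m_inv_closed[OF M_subgroup aM] by (simp add: C_def)
    qed
    show "a \<otimes>\<^bsub>S\<^esub> b \<in> C" if a: "a \<in> C" and b: "b \<in> C" for a b
    proof -
      have ab: "a \<in> M" "b \<in> M" using a b by (simp_all add: C_def)
      have "a \<otimes>\<^bsub>S\<^esub> b \<otimes>\<^bsub>S\<^esub> t = t \<otimes>\<^bsub>S\<^esub> (a \<otimes>\<^bsub>S\<^esub> b)" if jt: "j \<in> B" "t \<in> T j" for j t
      proof -
        have S: "t \<in> carrier S" "a \<in> carrier S" "b \<in> carrier S" using TS BI jt ab M_carrier by blast+
        have com: "a \<otimes>\<^bsub>S\<^esub> t = t \<otimes>\<^bsub>S\<^esub> a" "b \<otimes>\<^bsub>S\<^esub> t = t \<otimes>\<^bsub>S\<^esub> b" using a b jt by (simp_all add: C_def)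
        have "a \<otimes>\<^bsub>S\<^esub> b \<otimes>\<^bsub>S\<^esub> t = a \<otimes>\<^bsub>S\<^esub> t \<otimes>\<^bsub>S\<^esub> b" using S com(2) by (simp add: m_assoc)
        then show ?thesis using S com(1) by (simp add: m_assoc)
      qed
      then show ?thesis using subgroup.m_closed[OF M_subgroup ab] by (simp add: C_def)
    qed
  qed
  have Cconj: "conj_by g m \<in> C" if g: "g \<in> G" and m: "m \<in> C" for g m
  proof -
    have gS: "g \<in> carrier S" by (rule G_carrier[OF g])
    have mM: "m \<in> M" using m by (simp add: C_def)
    have mS: "m \<in> carrier S" by (rule M_carrier[OF mM])
    have "conj_by g m \<otimes>\<^bsub>S\<^esub> t = t \<otimes>\<^bsub>S\<^esub> conj_by g m" if jB: "j \<in> B" and t: "t \<in> T j" for j t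
    proof -
      have jI: "j \<in> {1..k}" by (rule BI[OF jB])
      obtain j' where j': "j' \<in> {1..k}" "conj_by (inv\<^bsub>S\<^esub> g) ` T j = T j'"
        by (rule conj_by_factor[OF G_inv[OF g] jI])
      have undo: "conj_by g (conj_by (inv\<^bsub>S\<^esub> g) s) = s" if "s \<in> T j" for s
        using conj_by_inv[OF inv_closed[OF gS] TS[OF jI that]] gS by simp
      have "T j = conj_by g ` T j'"
        unfolding j'(2)[symmetric] image_image using undo by (force simp: image_iff)
      then have "card (moved (T j)) \<le> card (moved (T j'))"
        using card_moved_conj_le[OF g, of "T j'"] TS[OF j'(1)] by auto
      then have "j' \<in> B" using jB j'(1) by (simp add: B_def)
      let ?t = "conj_by (inv\<^bsub>S\<^esub> g) t"
      have t': "?t \<in> T j'" using j'(2) t by blast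
      have "m \<otimes>\<^bsub>S\<^esub> ?t = ?t \<otimes>\<^bsub>S\<^esub> m" using m \<open>j' \<in> B\<close> t' by (simp add: C_def)
      then have "conj_by g (m \<otimes>\<^bsub>S\<^esub> ?t) = conj_by g (?t \<otimes>\<^bsub>S\<^esub> m)" by simp
      then show ?thesis
        using conj_by_mult[OF gS mS TS[OF j'(1) t']] conj_by_mult[OF gS TS[OF j'(1) t'] mS] undo[OF t]
        by simp
    qed
    then show ?thesis using M_conj[OF g mM] by (simp add: C_def)
  qed
  have "C = {\<one>\<^bsub>S\<^esub>} \<or> C = M"
    by (rule M_minimal_conj[OF Csub _ Cconj]) (auto simp: C_def)
  moreover have "C \<noteq> {\<one>\<^bsub>S\<^esub>}"
  proof
    have "T j0 \<subseteq> C"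
      using factor_in_M[OF j0] factors_commute[OF j0 BI] by (auto simp: C_def B_def)
    moreover assume "C = {\<one>\<^bsub>S\<^esub>}"
    ultimately have "card (T j0) \<le> card {\<one>\<^bsub>S\<^esub>}" by (intro card_mono) auto
    then show False using M.card_factor[OF j0] M.q_ge_2[OF j0] by simp
  qed
  ultimately have CM: "C = M" by blast
  have jB: "j \<in> B" using gt j by (simp add: B_def)
  obtain a b where ab: "a \<in> T j" "b \<in> T j" "a \<otimes>\<^bsub>perms P M\<^esub> b \<noteq> b \<otimes>\<^bsub>perms P M\<^esub> a"
    by (rule M.factor_witness[OF j])
  have "a \<in> C" using CM factor_in_M[OF j] ab(1) by blast
  then show False using jB ab by (simp add: C_def)
qed

text \<open>
  The double count: \<open>U i\<close> is the set of factors moving the coordinate \<open>i\<close>, each factor occurs in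
  exactly \<open>d\<close> of these sets, and the two bounds on \<open>q ^ card (U i)\<close> are multiplied over all \<open>i\<close>.
\<close>

lemma l_le_1_if_full_diagonal_stabilizer:
  assumes \<omega>: "\<omega> \<in> P" and full: "\<And>j. j \<in> {1..k} \<Longrightarrow> p j ` {m \<in> M. m \<omega> = \<omega>} = T j"
    and card_stab: "card {m \<in> M. m \<omega> = \<omega>} = q" and k: "k \<ge> 1"
  shows "l \<le> 1"
proof -
  let ?D = "{m \<in> M. m \<omega> = \<omega>}"
  define n where "n = card \<Gamma>"
  define K where "K = (\<lambda>i. {m \<in> M. m \<omega> i = \<omega> i})"
  have one_k: "1 \<in> {1..k}" using k by simp
  have q2: "q \<ge> 2" by (rule M.q_ge_2[OF one_k])
  have D: "subgroup ?D (perms P M)"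
    using M_stabilizer_subgroup[OF \<omega>] by (simp add: M_subgroup_iff)
  have finM: "finite M" using M.finite_carrier by simp
  have diag: "x = \<one>\<^bsub>perms P M\<^esub>" if x: "x \<in> ?D" and j: "j \<in> {1..k}" and px: "p j x = \<one>\<^bsub>perms P M\<^esub>" for x j
  proof -
    have "card (p j ` ?D) = card ?D" using full[OF j] card_stab M.card_factor[OF j] by simp
    then have inj: "inj_on (p j) ?D" using finM by (intro eq_card_imp_inj_on) auto
    have "p j x = p j \<one>\<^bsub>perms P M\<^esub>" using px M.proj_one[OF j] by simp
    then show ?thesis by (rule inj_onD[OF inj _ x subgroup.one_closed[OF D]])
  qed
  have card_M: "card M = q ^ k" using M.card_carrier by simp
  \<comment> \<open>The orbit-stabiliser theorem for the transitive action of \<open>M\<close>.\<close>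
  have nlq: "n ^ l * q = q ^ k" using card_M_P[OF \<omega>] card_stab card_M by (simp add: n_def)
  define U where "U = (\<lambda>i. {j \<in> {1..k}. \<not> T j \<subseteq> K i})"
  have bounds: "q ^ card (U i) \<le> n\<^sup>2 \<and> n * q \<le> q ^ card (U i)" if i: "i \<in> {1..l}" for i
  proof -
    have KM: "K i \<subseteq> M" and DK: "?D \<subseteq> K i" by (auto simp: K_def)
    have Ksub: "subgroup (K i) (perms P M)"
      using coordinate_stabilizer_subgroup[OF \<omega> i] M_subgroup_iff[OF KM] by (simp add: K_def)
    have sd: "p j ` K i = T j" if j: "j \<in> {1..k}" for j
    proof
      show "p j ` K i \<subseteq> T j" using M.proj_in[OF j] KM by auto
      show "T j \<subseteq> p j ` K i" using full[OF j] DK by blast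
    qed
    have index: "card (carrier (perms P M)) = n * card (K i)"
      using card_M_coordinate[OF \<omega> i] by (simp add: n_def K_def)
    have "n \<ge> 2" using card_base by (simp add: n_def)
    moreover have "card M > 0" using card_M q2 by simp
    ultimately have "K i \<noteq> carrier (perms P M)" using index by auto
    note bounds = M.subdirect_index_bounds[OF Ksub _ D DK card_stab _ index this]
    show ?thesis
      unfolding U_def by (intro conjI bounds) (use sd diag in blast)+
  qed
  define d where "d = card (moved (T 1))"
  have d: "card {i \<in> {1..l}. \<not> T j \<subseteq> K i} = d" if j: "j \<in> {1..k}" for j
  proof -
    have norm: "inv\<^bsub>S\<^esub> m \<otimes>\<^bsub>S\<^esub> t \<otimes>\<^bsub>S\<^esub> m \<in> T j" if "m \<in> M" "t \<in> T j" for m t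
      using factor_normal[OF j subgroup.m_inv_closed[OF M_subgroup that(1)] that(2)] M_carrier[OF that(1)]
      by simp
    have "{i \<in> {1..l}. \<not> T j \<subseteq> K i} = moved (T j)"
      using moved_normal_iff[OF factor_in_M[OF j] norm \<omega>] unfolding K_def by (auto simp: moved_def)
    moreover have "card (moved (T j)) = d"
      unfolding d_def using card_moved_factor_le[OF one_k j] card_moved_factor_le[OF j one_k] by simp
    ultimately show ?thesis by simp
  qed
  have "(\<Sum>i\<in>{1..l}. card (U i)) = (\<Sum>j\<in>{1..k}. d)"
    unfolding U_def by (rule sum_multicount_gen) (simp, simp, intro ballI d)
  then have sum_U: "(\<Sum>i\<in>{1..l}. card (U i)) = k * d" by simp
  \<comment> \<open>The upper bounds force \<open>d \<le> 1\<close>.\<close>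
  have "q ^ (k * d) = (\<Prod>i\<in>{1..l}. q ^ card (U i))" by (simp only: sum_U[symmetric] power_sum)
  also have "\<dots> \<le> (\<Prod>i\<in>{1..l}. n\<^sup>2)" using bounds by (intro prod_mono) auto
  also have "\<dots> = (n ^ l)\<^sup>2" by (simp add: power_mult[symmetric] mult.commute)
  finally have "q ^ (k * d) * q\<^sup>2 \<le> (n ^ l * q)\<^sup>2" by (simp add: power_mult_distrib)
  then have "q ^ (k * d + 2) \<le> q ^ (k * 2)" unfolding nlq power_add power_mult .
  then have "k * d + 2 \<le> k * 2" by (rule power_le_imp_le_exp[rotated]) (use q2 in simp)
  then have "k * d < k * 2" by linarith
  then have "d \<le> 1" by simp
  then have kd: "k * d \<le> k" by (cases "d = 0") auto
  \<comment> \<open>The lower bounds now force \<open>l \<le> 1\<close>.\<close>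
  have "(n * q) ^ l = (\<Prod>i\<in>{1..l}. n * q)" by simp
  also have "\<dots> \<le> (\<Prod>i\<in>{1..l}. q ^ card (U i))" using bounds by (intro prod_mono) auto
  also have "\<dots> = q ^ (k * d)" by (simp only: sum_U[symmetric] power_sum)
  also have "\<dots> \<le> q ^ k" using q2 kd by (intro power_increasing) auto
  finally have "n ^ l * q ^ l \<le> n ^ l * q" unfolding nlq power_mult_distrib .
  moreover have "n > 0" using card_base by (simp add: n_def)
  ultimately have "q ^ l \<le> q ^ 1" by simp
  then show "l \<le> 1" using q2 power_le_imp_le_exp[of q l 1] by simp
qed

end

theorem corollary1p3:
  fixes \<Gamma> :: "'a set" and l :: nat
  assumes "finite \<Gamma>" and "card \<Gamma> \<ge> 2" and "l \<ge> 2"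
  shows "\<not> (\<exists>G. innately_transitive (cartesian_power \<Gamma> l) G \<and>
                simple_diagonal_type (cartesian_power \<Gamma> l) G \<and>
                G \<subseteq> wreath_product_action \<Gamma> l)"
proof
  let ?P = "cartesian_power \<Gamma> l"
  assume "\<exists>G. innately_transitive ?P G \<and> simple_diagonal_type ?P G \<and> G \<subseteq> wreath_product_action \<Gamma> l"
  then obtain G M k T where W: "G \<subseteq> wreath_product_action \<Gamma> l"
    and it: "innately_transitive ?P G" and plinth: "plinth ?P G M"
    and dec: "nonabelian_simple_decomposition (perms ?P M) k T"
    and full: "\<forall>\<omega>\<in>?P. \<forall>i\<in>{1..k}.
        natural_projection (perms ?P M) k T i ` point_stabilizer ?P M \<omega> = T i"
    and iso: "\<forall>\<omega>\<in>?P. \<forall>i\<in>{1..k}. perms ?P (point_stabilizer ?P M \<omega>) \<cong> perms ?P (T i)"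
    unfolding simple_diagonal_type_def diagonal_type_wrt_def by blast
  interpret product_action_minimal_normal \<Gamma> l G M
  proof (rule product_action_minimal_normal.intro)
    show "subgroup G (BijGroup ?P)" using it by (simp add: innately_transitive_def permutation_group_def)
    show "minimal_normal_subgroup M (perms ?P G)" using plinth by (simp add: plinth_def)
    show "\<exists>m\<in>M. m \<gamma> = \<delta>" if "\<gamma> \<in> ?P" "\<delta> \<in> ?P" for \<gamma> \<delta>
      using plinth transitive_action.unique_orbit[OF _ that] by (fastforce simp: plinth_def)
  qed (use assms W in auto)
  have fin: "finite (carrier (perms P M))"
    using finite_subset[OF _ finite_BijGroup[OF finite_P]] M_carrier by auto
  interpret product_action_plinth \<Gamma> l G M k T "natural_projection (perms P M) k T" "card (T 1)"
    by (intro product_action_plinth.intro product_action_plinth_axioms.intro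
        product_action_minimal_normal_axioms)
      (rule nonabelian_simple_product_natural_projection[OF subgroup_imp_group[OF M_subgroup] fin dec])
  have k: "k \<ge> 1" using dec by (simp add: nonabelian_simple_decomposition_def)
  obtain c where "c \<in> \<Gamma>" using assms(2) by fastforce
  then have \<omega>: "(\<lambda>_\<in>{1..l}. c) \<in> P" by (rule const_in_P)
  let ?\<omega> = "\<lambda>_\<in>{1..l}. c"
  have stab: "point_stabilizer P M \<gamma> = {m \<in> M. m \<gamma> = \<gamma>}" for \<gamma> by (simp add: stabilizer_def)
  have "perms P (point_stabilizer P M ?\<omega>) \<cong> perms P (T 1)" using iso \<omega> k by simp
  then have "card (point_stabilizer P M ?\<omega>) = card (T 1)"
    by (auto simp: is_iso_def iso_def dest: bij_betw_same_card)
  then have "l \<le> 1"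
    using l_le_1_if_full_diagonal_stabilizer[OF \<omega> _ _ k] full \<omega> unfolding stab by blast
  then show False using assms(3) by simp
qed

end
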